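(* Let $D=(V,A)$ be a finite non-Eulerian oriented graph with $m\ge 1$ arcs, and let $$\gamma_D:=\inf_{(\xi,\beta)\in\mathbb{R}^2\setminus\{(0,0)\}}\frac{\sum_{v\in V}\left(d^+(v)\xi+d^-(v)\beta\right)^2}{\xi^2+\beta^2}.$$ Let $W\colon[0,1]^2\to[0,1]$ be a directed kernel. Suppose $0<\alpha\le W\le 1$ almost everywhere and put $M:=\log(1/\alpha)$. Then $\gamma_D>0$ and, with $\bar u:=\int_{[0,1]^2}\log W$, $$\|\log W-\bar u\|_2^2\le\max\left\{\frac1{\gamma_D},\ \frac1m\right\}\left(2e^{mM}+m^2M^2\right)M\,\Delta_D(W).$$
   Context: A finite oriented graph $D=(V,A)$ is a finite directed graph with no loops, no repeated arcs and no pairs of opposite arcs; $d^+(v)$ and $d^-(v)$ denote the outdegree and indegree of $v$. $D$ is Eulerian if $d^+(v)=d^-(v)$ for every non-isolated vertex $v$. A directed kernel is a measurable function $W\colon[0,1]^2\to[0,1]$, not assumed symmetric. Integrals are with respect to Lebesgue measure; $\|\cdot\|_2$ is the $L^2$ norm on $[0,1]^2$. Define $$t(D,W):=\int_{[0,1]^V}\prod_{(i,j)\in A}W(x_i,x_j)\prod_{i\in V}dx_i.$$ For an arc $b=(i,j)\in A$, the arc-rooted density $r_b^W(x,y)$ is obtained from the same integrand by fixing $x_i=x$, $x_j=y$ and integrating the remaining vertex variables. When $t(D,W)>0$ (which holds here since $W\ge\alpha>0$), put $q_b^W:=r_b^W/t(D,W)$ and $$\Delta_D(W):=\sum_{b\in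 A}\|q_b^W-1\|_{L^1([0,1]^2)}.$$ *)

theory Defs
  imports "HOL-Analysis.Analysis" "Graph_Theory.Digraph"
begin

text \<open>The locale \<open>digraph\<close> of \<open>Graph_Theory\<close> provides finiteness and excludes loops and
  repeated arcs. An arc \<open>e\<close> stands for the pair \<open>(tail D e, head D e)\<close>.\<close>

definition oriented_graph :: "('v, 'e) pre_digraph \<Rightarrow> bool" where
  "oriented_graph D \<longleftrightarrow> digraph D \<and>
     (\<forall>e\<in>arcs D. \<forall>e'\<in>arcs D. \<not> (tail D e = head D e' \<and> head D e = tail D e'))"

definition isolated_vertex :: "('v, 'e) pre_digraph \<Rightarrow> 'v \<Rightarrow> bool" where
  "isolated_vertex D v \<longleftrightarrow> v \<in> verts D \<and> out_arcs D v = {} \<and> in_arcs D v = {}"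

text \<open>Unlike \<open>Graph_Theory.Euler\<close>, this notion does not require connectedness.\<close>

definition eulerian :: "('v, 'e) pre_digraph \<Rightarrow> bool" where
  "eulerian D \<longleftrightarrow>
     (\<forall>v\<in>verts D. \<not> isolated_vertex D v \<longrightarrow> out_degree D v = in_degree D v)"

definition degree_gap :: "('v, 'e) pre_digraph \<Rightarrow> real" where
  "degree_gap D = (INF (\<xi>, \<beta>) \<in> UNIV - {(0, 0)}.
     (\<Sum>v\<in>verts D. (real (out_degree D v) * \<xi> + real (in_degree D v) * \<beta>)\<^sup>2)
       / (\<xi>\<^sup>2 + \<beta>\<^sup>2))"

definition unit_square :: "(real \<times> real) measure" where
  "unit_square = lebesgue_on ({0..1} \<times> {0..1})"

text \<open>Lebesgue measure on \<open>[0,1]\<^sup>V\<close>. Since kernels are only assumed Lebesgue measurable, the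
  completion is essential: \<open>x \<mapsto> W (x i, x j)\<close> need not be measurable with respect to the
  product of the one-dimensional \<open>\<sigma>\<close>-algebras.\<close>

definition unit_cube :: "'v set \<Rightarrow> ('v \<Rightarrow> real) measure" where
  "unit_cube V = completion (PiM V (\<lambda>_. restrict_space lborel {0..1}))"

text \<open>Values of \<open>W\<close> outside the unit square are irrelevant.\<close>

definition directed_kernel :: "(real \<times> real \<Rightarrow> real) \<Rightarrow> bool" where
  "directed_kernel W \<longleftrightarrow>
     W \<in> borel_measurable unit_square \<and> (\<forall>p \<in> {0..1} \<times> {0..1}. 0 \<le> W p \<and> W p \<le> 1)"

definition hom_integrand ::
  "('v, 'e) pre_digraph \<Rightarrow> (real \<times> real \<Rightarrow> real) \<Rightarrow> ('v \<Rightarrow> real) \<Rightarrow> real" where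
  "hom_integrand D W x = (\<Prod>e\<in>arcs D. W (x (tail D e), x (head D e)))"

definition hom_density :: "('v, 'e) pre_digraph \<Rightarrow> (real \<times> real \<Rightarrow> real) \<Rightarrow> real" where
  "hom_density D W = (\<integral>x. hom_integrand D W x \<partial>unit_cube (verts D))"

definition arc_rooted_density ::
  "('v, 'e) pre_digraph \<Rightarrow> (real \<times> real \<Rightarrow> real) \<Rightarrow> 'e \<Rightarrow> real \<times> real \<Rightarrow> real" where
  "arc_rooted_density D W b = (\<lambda>(x, y).
     \<integral>z. hom_integrand D W (z(tail D b := x, head D b := y))
       \<partial>unit_cube (verts D - {tail D b, head D b}))"

definition normalized_arc_density ::
  "('v, 'e) pre_digraph \<Rightarrow> (real \<times> real \<Rightarrow> real) \<Rightarrow> 'e \<Rightarrow> real \<times> real \<Rightarrow> real" where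
  "normalized_arc_density D W b p = arc_rooted_density D W b p / hom_density D W"

definition L1_norm :: "(real \<times> real \<Rightarrow> real) \<Rightarrow> real" where
  "L1_norm f = (\<integral>p. \<bar>f p\<bar> \<partial>unit_square)"

definition L2_norm :: "(real \<times> real \<Rightarrow> real) \<Rightarrow> real" where
  "L2_norm f = sqrt (\<integral>p. (f p)\<^sup>2 \<partial>unit_square)"

definition arc_discrepancy :: "('v, 'e) pre_digraph \<Rightarrow> (real \<times> real \<Rightarrow> real) \<Rightarrow> real" where
  "arc_discrepancy D W =
     (\<Sum>b\<in>arcs D. L1_norm (\<lambda>p. normalized_arc_density D W b p - 1))"

end

theory Submission
  imports Defs "HOL-Probability.Infinite_Product_Measure"
begin

text \<open>Put \<open>f = log W\<close> and let \<open>S(x) = \<Sum>(i,j)\<in>A. f(x\<^sub>i, x\<^sub>j)\<close> on the cube, so that the homomorphism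
  integrand is \<open>exp S\<close> and \<open>E S = m * ubar\<close>. The proof compares the variance of \<open>S\<close> with both
  sides of the inequality.

  From above: since \<open>exp\<close> has slope at least \<open>exp (- m M)\<close> on the interval \<open>[- m M, 0]\<close> that
  contains the values of \<open>S\<close>, \<open>exp (- m M) * Var S \<le> Cov (exp S, S)\<close>. Splitting the second \<open>S\<close> into
  arcs and integrating out the other vertices turns the covariance into
  \<open>\<Sum>b. \<integral> r\<^sub>b * (f - ubar) = t * (\<Sum>b. \<integral> (q\<^sub>b - 1) * (f - ubar))\<close>, which is at most \<open>t M \<Delta>\<close> because
  \<open>\<bar>f - ubar\<bar> \<le> M\<close>. As \<open>t \<le> 1\<close>, this gives \<open>Var S \<le> exp (m M) * M * \<Delta>\<close>
  (\<open>variance_arc_sum_le_exp_discrepancy\<close>).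

  From below: write the Hoeffding decomposition \<open>f(x,y) = ubar + a(x) + b(y) + c(x,y)\<close> with centred
  \<open>a\<close>, \<open>b\<close> and with \<open>c\<close> centred in each variable. Collecting the one-variable terms by vertices,
  \<open>S - m * ubar = (\<Sum>v. d\<^sup>+(v) a(x\<^sub>v) + d\<^sup>-(v) b(x\<^sub>v)) + (\<Sum>(i,j)\<in>A. c(x\<^sub>i, x\<^sub>j))\<close>. All these summands are
  pairwise orthogonal; for two arcs this uses that one of them has an endpoint that the other one
  avoids, which is what an oriented graph guarantees. Hence \<open>Var S\<close> is the integral of the quadratic
  form defining the degree gap, evaluated at \<open>(a, b)\<close>, plus \<open>m * \<parallel>c\<parallel>\<^sup>2\<close> (\<open>variance_arc_sum\<close>), whereas
  \<open>\<parallel>f - ubar\<parallel>\<^sup>2 = \<parallel>a\<parallel>\<^sup>2 + \<parallel>b\<parallel>\<^sup>2 + \<parallel>c\<parallel>\<^sup>2\<close>; so \<open>\<parallel>f - ubar\<parallel>\<^sup>2 \<le> max (1/\<gamma>) (1/m) * Var S\<close>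
  (\<open>square_distance_le_variance_arc_sum\<close>).

  Positivity of the gap: if the form vanishes at \<open>(\<xi>, \<beta>)\<close>, summing over the vertices gives
  \<open>m * (\<xi> + \<beta>) = 0\<close>, hence \<open>(d\<^sup>+(v) - d\<^sup>-(v)) * \<xi> = 0\<close> for all \<open>v\<close>, and a vertex with unequal degrees
  forces \<open>\<xi> = \<beta> = 0\<close>; compactness of the circle does the rest.

  These arguments work over an arbitrary probability space with its product \<open>\<sigma>\<close>-algebras. Lebesgue
  measurable kernels are reduced to this setting by replacing \<open>W\<close> with \<open>exp f\<close> for a Borel
  function \<open>f\<close>, which changes every quantity involved only on null sets.\<close>

section \<open>Bounded measurable functions\<close>

text \<open>A class of functions that is closed under all operations below and consists of integrable
  functions on a finite measure space, so that integrability never has to be argued separately.\<close>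

definition bounded_measurable :: "'a measure \<Rightarrow> ('a \<Rightarrow> real) set" where
  "bounded_measurable M = {f \<in> borel_measurable M. \<exists>B. \<forall>x\<in>space M. \<bar>f x\<bar> \<le> B}"

lemma bounded_measurableI:
  assumes "f \<in> borel_measurable M" "\<And>x. x \<in> space M \<Longrightarrow> \<bar>f x\<bar> \<le> B"
  shows "f \<in> bounded_measurable M"
  using assms by (auto simp: bounded_measurable_def)

lemma bounded_measurable_borel: "f \<in> bounded_measurable M \<Longrightarrow> f \<in> borel_measurable M"
  by (simp add: bounded_measurable_def)

lemma bounded_measurable_const: "(\<lambda>_. c) \<in> bounded_measurable M"
  by (rule bounded_measurableI[where B = "\<bar>c\<bar>"]) auto

lemma bounded_measurable_add:
  assumes "f \<in> bounded_measurable M" "g \<in> bounded_measurable M"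
  shows "(\<lambda>x. f x + g x) \<in> bounded_measurable M"
proof -
  obtain B C where "\<forall>x\<in>space M. \<bar>f x\<bar> \<le> B" "\<forall>x\<in>space M. \<bar>g x\<bar> \<le> C"
    using assms by (auto simp: bounded_measurable_def)
  then have "\<bar>f x + g x\<bar> \<le> B + C" if "x \<in> space M" for x
    using that by (intro order_trans[OF abs_triangle_ineq] add_mono) auto
  moreover have "f \<in> borel_measurable M" "g \<in> borel_measurable M"
    using assms by (auto dest: bounded_measurable_borel)
  ultimately show ?thesis
    by (intro bounded_measurableI) simp_all
qed

lemma bounded_measurable_mult:
  assumes "f \<in> bounded_measurable M" "g \<in> bounded_measurable M"
  shows "(\<lambda>x. f x * g x) \<in> bounded_measurable M"
proof -
  obtain B C where "\<forall>x\<in>space M. \<bar>f x\<bar> \<le> B" "\<forall>x\<in>space M. \<bar>g x\<bar> \<le> C"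
    using assms by (auto simp: bounded_measurable_def)
  then have "\<bar>f x * g x\<bar> \<le> \<bar>B\<bar> * \<bar>C\<bar>" if "x \<in> space M" for x
    unfolding abs_mult using that by (intro mult_mono) force+
  moreover have "f \<in> borel_measurable M" "g \<in> borel_measurable M"
    using assms by (auto dest: bounded_measurable_borel)
  ultimately show ?thesis
    by (intro bounded_measurableI) simp_all
qed

lemma bounded_measurable_diff:
  assumes "f \<in> bounded_measurable M" "g \<in> bounded_measurable M"
  shows "(\<lambda>x. f x - g x) \<in> bounded_measurable M"
  using bounded_measurable_add[OF assms(1)
      bounded_measurable_mult[OF bounded_measurable_const[where c = "-1"] assms(2)]] by simp

lemma bounded_measurable_power2:
  "f \<in> bounded_measurable M \<Longrightarrow> (\<lambda>x. (f x)\<^sup>2) \<in> bounded_measurable M"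
  using bounded_measurable_mult[of f M f] by (simp add: power2_eq_square)

lemma bounded_measurable_sum:
  assumes "\<And>i. i \<in> I \<Longrightarrow> f i \<in> bounded_measurable M"
  shows "(\<lambda>x. \<Sum>i\<in>I. f i x) \<in> bounded_measurable M"
  using assms by (induction I rule: infinite_finite_induct)
    (auto intro: bounded_measurable_const bounded_measurable_add)

lemma bounded_measurable_compose:
  assumes "f \<in> bounded_measurable N" "h \<in> M \<rightarrow>\<^sub>M N"
  shows "(\<lambda>x. f (h x)) \<in> bounded_measurable M"
proof -
  obtain B where "\<forall>x\<in>space N. \<bar>f x\<bar> \<le> B" and f: "f \<in> borel_measurable N"
    using assms by (auto simp: bounded_measurable_def)
  then show ?thesis
    using measurable_compose[OF assms(2) f] measurable_space[OF assms(2)]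
    by (intro bounded_measurableI) auto
qed

lemma bounded_measurable_exp:
  assumes "g \<in> bounded_measurable N"
  shows "(\<lambda>x. exp (g x)) \<in> bounded_measurable N"
proof -
  obtain B where B: "\<forall>x\<in>space N. \<bar>g x\<bar> \<le> B" and g: "g \<in> borel_measurable N"
    using assms by (auto simp: bounded_measurable_def)
  show ?thesis
  proof (rule bounded_measurableI)
    show "(\<lambda>x. exp (g x)) \<in> borel_measurable N"
      by (rule measurable_compose[OF g]) simp
    show "\<bar>exp (g x)\<bar> \<le> exp B" if "x \<in> space N" for x
      using B that by force
  qed
qed

lemmas bounded_measurable_intros = bounded_measurable_const bounded_measurable_add
  bounded_measurable_mult bounded_measurable_diff bounded_measurable_power2 bounded_measurable_sum

lemma (in finite_measure) integrable_bounded_measurable: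
  assumes "f \<in> bounded_measurable M"
  shows "integrable M f"
proof -
  obtain B where "\<forall>x\<in>space M. \<bar>f x\<bar> \<le> B" and "f \<in> borel_measurable M"
    using assms by (auto simp: bounded_measurable_def)
  then show ?thesis by (intro integrable_const_bound[where B = B]) auto
qed

lemma (in prob_space) bounded_measurable_partial_integral:
  assumes f: "f \<in> bounded_measurable (N \<Otimes>\<^sub>M M)"
  shows "(\<lambda>x. \<integral>y. f (x, y) \<partial>M) \<in> bounded_measurable N"
proof -
  obtain B where B: "\<forall>q\<in>space (N \<Otimes>\<^sub>M M). \<bar>f q\<bar> \<le> B" and m: "f \<in> borel_measurable (N \<Otimes>\<^sub>M M)"
    using f by (auto simp: bounded_measurable_def)
  show ?thesis
  proof (rule bounded_measurableI)
    show "(\<lambda>x. \<integral>y. f (x, y) \<partial>M) \<in> borel_measurable N"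
      by (rule borel_measurable_lebesgue_integral) (use m in simp)
    fix x assume x: "x \<in> space N"
    have int: "integrable M (\<lambda>y. f (x, y))"
      by (intro integrable_bounded_measurable bounded_measurable_compose[OF f])
         (rule measurable_Pair1'[OF x])
    have "\<bar>\<integral>y. f (x, y) \<partial>M\<bar> \<le> (\<integral>y. \<bar>f (x, y)\<bar> \<partial>M)"
      by (rule integral_abs_bound)
    also have "\<dots> \<le> (\<integral>y. B \<partial>M)"
      using B x int by (intro integral_mono) (auto simp: space_pair_measure)
    finally show "\<bar>\<integral>y. f (x, y) \<partial>M\<bar> \<le> B" by (simp add: prob_space)
  qed
qed

text \<open>Pythagoras, used for the vertex terms and for the arc terms separately.\<close>

lemma (in finite_measure) integral_square_sum_orthogonal:
  assumes "finite I" and f: "\<And>i. i \<in> I \<Longrightarrow> f i \<in> bounded_measurable M"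
    and orth: "\<And>i j. i \<in> I \<Longrightarrow> j \<in> I \<Longrightarrow> i \<noteq> j \<Longrightarrow> (\<integral>x. f i x * f j x \<partial>M) = 0"
  shows "(\<integral>x. (\<Sum>i\<in>I. f i x)\<^sup>2 \<partial>M) = (\<Sum>i\<in>I. \<integral>x. (f i x)\<^sup>2 \<partial>M)"
proof -
  have int: "integrable M (\<lambda>x. f i x * f j x)" if "i \<in> I" "j \<in> I" for i j
    using that f by (intro integrable_bounded_measurable bounded_measurable_mult)
  have "(\<integral>x. (\<Sum>i\<in>I. f i x)\<^sup>2 \<partial>M) = (\<integral>x. (\<Sum>i\<in>I. \<Sum>j\<in>I. f i x * f j x) \<partial>M)"
    by (simp add: power2_eq_square sum_product)
  also have "\<dots> = (\<Sum>i\<in>I. \<Sum>j\<in>I. \<integral>x. f i x * f j x \<partial>M)"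
    using int by (simp add: Bochner_Integration.integral_sum)
  also have "\<dots> = (\<Sum>i\<in>I. \<integral>x. f i x * f i x \<partial>M)"
  proof (rule sum.cong[OF refl])
    fix i assume i: "i \<in> I"
    have "(\<Sum>j\<in>I. \<integral>x. f i x * f j x \<partial>M) = (\<Sum>j\<in>I. if j = i then \<integral>x. f i x * f i x \<partial>M else 0)"
      using orth[OF i] by (intro sum.cong) auto
    then show "(\<Sum>j\<in>I. \<integral>x. f i x * f j x \<partial>M) = (\<integral>x. f i x * f i x \<partial>M)"
      using i \<open>finite I\<close> by simp
  qed
  finally show ?thesis by (simp add: power2_eq_square)
qed

section \<open>Finite powers of a probability space\<close>

context prob_space
begin

abbreviation power_measure :: "'v set \<Rightarrow> ('v \<Rightarrow> 'a) measure" where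
  "power_measure V \<equiv> PiM V (\<lambda>_. M)"

lemma prob_space_power: "prob_space (power_measure V)"
  by (intro prob_space_PiM) (rule prob_space_axioms)

lemma prob_space_square: "prob_space (M \<Otimes>\<^sub>M M)"
  by (intro prob_space_pair prob_space_axioms)

lemma measurable_two_coordinates:
  assumes "i \<in> V" "j \<in> V"
  shows "(\<lambda>x. (x i, x j)) \<in> power_measure V \<rightarrow>\<^sub>M M \<Otimes>\<^sub>M M"
  using assms by measurable

text \<open>Gluing a point of the square, for the coordinates \<open>i\<close> and \<open>j\<close>, to a point of the remaining
  cube. A single argument \<open>q = (p, z)\<close> makes it a map between measure spaces.\<close>

definition insert_pair :: "'v \<Rightarrow> 'v \<Rightarrow> ('a \<times> 'a) \<times> ('v \<Rightarrow> 'a) \<Rightarrow> 'v \<Rightarrow> 'a" where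
  "insert_pair i j q = (snd q)(i := fst (fst q), j := snd (fst q))"

lemma measurable_insert_pair:
  assumes "i \<in> V" "j \<in> V"
  shows "insert_pair i j \<in> (M \<Otimes>\<^sub>M M) \<Otimes>\<^sub>M power_measure (V - {i, j}) \<rightarrow>\<^sub>M power_measure V"
proof (rule measurable_PiM_single')
  let ?P = "(M \<Otimes>\<^sub>M M) \<Otimes>\<^sub>M power_measure (V - {i, j})"
  fix k assume "k \<in> V"
  consider "k = j" | "k \<noteq> j" "k = i" | "k \<in> V - {i, j}" using \<open>k \<in> V\<close> by blast
  then show "(\<lambda>q. insert_pair i j q k) \<in> ?P \<rightarrow>\<^sub>M M"
  proof cases
    case 1
    then have "(\<lambda>q. insert_pair i j q k) = (\<lambda>q. snd (fst q))"
      by (simp add: insert_pair_def)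
    then show ?thesis
      by (simp only: measurable_compose[OF measurable_fst measurable_snd])
  next
    case 2
    then have "(\<lambda>q. insert_pair i j q k) = (\<lambda>q. fst (fst q))"
      by (simp add: insert_pair_def)
    then show ?thesis
      by (simp only: measurable_compose[OF measurable_fst measurable_fst])
  next
    case 3
    then have eq: "(\<lambda>q. insert_pair i j q k) = (\<lambda>q. snd q k)"
      by (simp add: insert_pair_def)
    show ?thesis
      unfolding eq
      by (rule measurable_compose[OF measurable_snd
            measurable_component_singleton[OF 3, of "\<lambda>_. M"]])
  qed
next
  have "insert_pair i j q \<in> V \<rightarrow>\<^sub>E space M"
    if q: "q \<in> space ((M \<Otimes>\<^sub>M M) \<Otimes>\<^sub>M power_measure (V - {i, j}))" for q
  proof (rule PiE_I)
    have *: "fst (fst q) \<in> space M" "snd (fst q) \<in> space M"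
      "snd q \<in> V - {i, j} \<rightarrow>\<^sub>E space M"
      using q by (simp_all add: space_pair_measure space_PiM mem_Times_iff)
    show "insert_pair i j q k \<in> space M" if "k \<in> V" for k
      using *(1,2) PiE_mem[OF *(3), of k] that by (simp add: insert_pair_def)
    show "insert_pair i j q k = undefined" if "k \<notin> V" for k
    proof -
      have "k \<noteq> i" "k \<noteq> j" using that assms by blast+
      then show ?thesis using that PiE_arb[OF *(3), of k] by (simp add: insert_pair_def)
    qed
  qed
  then show "insert_pair i j \<in> space ((M \<Otimes>\<^sub>M M) \<Otimes>\<^sub>M power_measure (V - {i, j})) \<rightarrow> V \<rightarrow>\<^sub>E space M"
    by blast
qed

text \<open>Both measures agree on boxes. Two-coordinate marginals and the integrals defining arc-rooted
  densities are obtained from this splitting of the cube.\<close>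

lemma distr_insert_pair:
  assumes "finite V" and ij: "i \<in> V" "j \<in> V" "i \<noteq> j"
  shows "distr ((M \<Otimes>\<^sub>M M) \<Otimes>\<^sub>M power_measure (V - {i, j})) (power_measure V) (insert_pair i j)
    = power_measure V"
proof -
  interpret P: product_sigma_finite "\<lambda>_. M"
    by standard
  interpret F: finite_product_sigma_finite "\<lambda>_. M" "V - {i, j}"
    by standard (use \<open>finite V\<close> in simp)
  interpret R: prob_space "power_measure (V - {i, j})"
    by (rule prob_space_power)
  show ?thesis
  proof (rule P.PiM_eqI)
    fix A assume A: "\<And>k. k \<in> V \<Longrightarrow> A k \<in> sets M"
    have A_space: "A k \<subseteq> space M" if "k \<in> V" for k
      using A[OF that] by (rule sets.sets_into_space)
    have "q \<in> insert_pair i j -` Pi\<^sub>E V A \<inter> space ((M \<Otimes>\<^sub>M M) \<Otimes>\<^sub>M power_measure (V - {i, j}))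
        \<longleftrightarrow> q \<in> (A i \<times> A j) \<times> Pi\<^sub>E (V - {i, j}) A" (is "?l \<longleftrightarrow> ?r") for q
    proof
      assume q: ?l
      have *: "insert_pair i j q k \<in> A k" if "k \<in> V" for k
        using q that by (auto simp: PiE_iff)
      have "snd q k \<in> A k" if "k \<in> V - {i, j}" for k
        using *[of k] that by (simp add: insert_pair_def)
      moreover have "snd q \<in> extensional (V - {i, j})"
        using q by (auto simp: space_pair_measure space_PiM PiE_iff)
      moreover have "fst (fst q) \<in> A i" "snd (fst q) \<in> A j"
        using *[of i] *[of j] ij by (simp_all add: insert_pair_def)
      ultimately show ?r
        by (simp add: mem_Times_iff PiE_iff)
    next
      assume q: ?r
      have "fst (fst q) \<in> space M" "snd (fst q) \<in> space M"
        using q A_space[OF ij(1)] A_space[OF ij(2)] by (auto simp: mem_Times_iff)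
      moreover have "snd q k \<in> space M" if "k \<in> V - {i, j}" for k
        using q that A_space[of k] by (auto simp: mem_Times_iff PiE_iff)
      moreover have "snd q \<in> extensional (V - {i, j})"
        using q by (simp add: mem_Times_iff PiE_iff)
      ultimately have "q \<in> space ((M \<Otimes>\<^sub>M M) \<Otimes>\<^sub>M power_measure (V - {i, j}))"
        by (simp add: space_pair_measure space_PiM mem_Times_iff PiE_iff)
      moreover have "insert_pair i j q k \<in> A k" if "k \<in> V" for k
        using q that by (auto simp: insert_pair_def mem_Times_iff PiE_iff)
      moreover have "insert_pair i j q \<in> extensional V"
        using q ij by (auto simp: insert_pair_def mem_Times_iff PiE_iff extensional_def)
      ultimately show ?l
        by (simp add: PiE_iff)
    qed
    then have vimage: "insert_pair i j -` Pi\<^sub>E V A \<inter> space ((M \<Otimes>\<^sub>M M) \<Otimes>\<^sub>M power_measure (V - {i, j}))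
        = (A i \<times> A j) \<times> Pi\<^sub>E (V - {i, j}) A"
      by blast
    have "emeasure (distr ((M \<Otimes>\<^sub>M M) \<Otimes>\<^sub>M power_measure (V - {i, j}))
        (power_measure V) (insert_pair i j)) (Pi\<^sub>E V A)
        = emeasure ((M \<Otimes>\<^sub>M M) \<Otimes>\<^sub>M power_measure (V - {i, j}))
            ((A i \<times> A j) \<times> Pi\<^sub>E (V - {i, j}) A)"
      unfolding vimage[symmetric]
      by (rule emeasure_distr[OF measurable_insert_pair[OF ij(1,2)]])
         (use A \<open>finite V\<close> in \<open>intro sets_PiM_I_finite; simp\<close>)
    also have "\<dots> = emeasure (M \<Otimes>\<^sub>M M) (A i \<times> A j)
        * emeasure (power_measure (V - {i, j})) (Pi\<^sub>E (V - {i, j}) A)"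
      by (rule F.emeasure_pair_measure_Times)
         (use A ij \<open>finite V\<close> in \<open>auto intro!: sets_PiM_I_finite\<close>)
    also have "emeasure (M \<Otimes>\<^sub>M M) (A i \<times> A j) = emeasure M (A i) * emeasure M (A j)"
      using A ij by (intro emeasure_pair_measure_Times) auto
    also have "emeasure (power_measure (V - {i, j})) (Pi\<^sub>E (V - {i, j}) A)
        = (\<Prod>k\<in>V - {i, j}. emeasure M (A k))"
      by (rule F.measure_times) (use A in auto)
    also have "emeasure M (A i) * emeasure M (A j) * (\<Prod>k\<in>V - {i, j}. emeasure M (A k))
        = (\<Prod>k\<in>V. emeasure M (A k))"
    proof -
      have "V - {i} - {j} = V - {i, j}" by auto
      then show ?thesis
        using ij \<open>finite V\<close> prod.remove[of V i "\<lambda>k. emeasure M (A k)"]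
          prod.remove[of "V - {i}" j "\<lambda>k. emeasure M (A k)"]
        by (simp add: mult.assoc)
    qed
    finally show "emeasure (distr ((M \<Otimes>\<^sub>M M) \<Otimes>\<^sub>M power_measure (V - {i, j}))
        (power_measure V) (insert_pair i j)) (Pi\<^sub>E V A) = (\<Prod>k\<in>V. emeasure M (A k))" .
  qed (rule \<open>finite V\<close>, rule sets_distr)
qed

lemma integral_insert_pair:
  assumes "finite V" and ij: "i \<in> V" "j \<in> V" "i \<noteq> j"
    and f: "f \<in> bounded_measurable (power_measure V)"
  shows "(\<integral>x. f x \<partial>power_measure V)
    = (\<integral>p. (\<integral>z. f (insert_pair i j (p, z)) \<partial>power_measure (V - {i, j})) \<partial>(M \<Otimes>\<^sub>M M))"
proof -
  interpret Q: prob_space "M \<Otimes>\<^sub>M M" by (rule prob_space_square)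
  interpret R: prob_space "power_measure (V - {i, j})" by (rule prob_space_power)
  interpret QR: pair_prob_space "M \<Otimes>\<^sub>M M" "power_measure (V - {i, j})" ..
  let ?P = "(M \<Otimes>\<^sub>M M) \<Otimes>\<^sub>M power_measure (V - {i, j})"
  have meas: "insert_pair i j \<in> ?P \<rightarrow>\<^sub>M power_measure V"
    by (rule measurable_insert_pair[OF ij(1,2)])
  have "(\<integral>x. f x \<partial>power_measure V) = (\<integral>x. f x \<partial>distr ?P (power_measure V) (insert_pair i j))"
    by (simp only: distr_insert_pair[OF assms(1-4)])
  also have "\<dots> = (\<integral>q. f (insert_pair i j q) \<partial>?P)"
    by (rule integral_distr[OF meas bounded_measurable_borel[OF f]])
  also have "\<dots>
      = (\<integral>p. (\<integral>z. f (insert_pair i j (p, z)) \<partial>power_measure (V - {i, j})) \<partial>(M \<Otimes>\<^sub>M M))"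
    by (rule QR.integral_fst'[OF QR.integrable_bounded_measurable[OF
            bounded_measurable_compose[OF f meas]], symmetric])
  finally show ?thesis .
qed

lemma distr_two_coordinates:
  assumes "finite V" and ij: "i \<in> V" "j \<in> V" "i \<noteq> j"
  shows "distr (power_measure V) (M \<Otimes>\<^sub>M M) (\<lambda>x. (x i, x j)) = M \<Otimes>\<^sub>M M"
proof -
  interpret R: prob_space "power_measure (V - {i, j})" by (rule prob_space_power)
  let ?P = "(M \<Otimes>\<^sub>M M) \<Otimes>\<^sub>M power_measure (V - {i, j})"
  have "distr (power_measure V) (M \<Otimes>\<^sub>M M) (\<lambda>x. (x i, x j))
      = distr (distr ?P (power_measure V) (insert_pair i j)) (M \<Otimes>\<^sub>M M) (\<lambda>x. (x i, x j))"
    by (simp only: distr_insert_pair[OF assms])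
  also have "\<dots> = distr ?P (M \<Otimes>\<^sub>M M) ((\<lambda>x. (x i, x j)) \<circ> insert_pair i j)"
    by (rule distr_distr[OF measurable_two_coordinates[OF ij(1,2)]
          measurable_insert_pair[OF ij(1,2)]])
  also have "(\<lambda>x. (x i, x j)) \<circ> insert_pair i j = fst"
    using ij by (auto simp: insert_pair_def)
  also have "distr ?P (M \<Otimes>\<^sub>M M) fst = M \<Otimes>\<^sub>M M"
    by (rule R.distr_pair_fst)
  finally show ?thesis .
qed

lemma integral_two_coordinates:
  assumes "finite V" "i \<in> V" "j \<in> V" "i \<noteq> j" and f: "f \<in> borel_measurable (M \<Otimes>\<^sub>M M)"
  shows "(\<integral>x. f (x i, x j) \<partial>power_measure V) = (\<integral>p. f p \<partial>(M \<Otimes>\<^sub>M M) :: real)"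
  using integral_distr[OF measurable_two_coordinates[OF assms(2,3)] f]
  unfolding distr_two_coordinates[OF assms(1-4)] by (rule sym)

lemma AE_two_coordinates:
  assumes "finite V" "i \<in> V" "j \<in> V" "i \<noteq> j" and "AE p in M \<Otimes>\<^sub>M M. P p"
  shows "AE x in power_measure V. P (x i, x j)"
proof (rule AE_distrD[OF measurable_two_coordinates[OF assms(2,3)]])
  show "AE p in distr (power_measure V) (M \<Otimes>\<^sub>M M) (\<lambda>x. (x i, x j)). P p"
    unfolding distr_two_coordinates[OF assms(1-4)] by (rule assms(5))
qed

lemma AE_insert_pair:
  assumes "finite V" and ij: "i \<in> V" "j \<in> V" "i \<noteq> j" and "AE x in power_measure V. P x"
  shows "AE p in M \<Otimes>\<^sub>M M. AE z in power_measure (V - {i, j}). P (insert_pair i j (p, z))"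
proof -
  interpret Q: prob_space "M \<Otimes>\<^sub>M M" by (rule prob_space_square)
  interpret R: prob_space "power_measure (V - {i, j})" by (rule prob_space_power)
  interpret QR: pair_prob_space "M \<Otimes>\<^sub>M M" "power_measure (V - {i, j})" ..
  have "AE q in (M \<Otimes>\<^sub>M M) \<Otimes>\<^sub>M power_measure (V - {i, j}). P (insert_pair i j q)"
  proof (rule AE_distrD[OF measurable_insert_pair[OF ij(1,2)]])
    show "AE x in distr ((M \<Otimes>\<^sub>M M) \<Otimes>\<^sub>M power_measure (V - {i, j})) (power_measure V)
        (insert_pair i j). P x"
      unfolding distr_insert_pair[OF assms(1-4)] by (rule assms(5))
  qed
  then show ?thesis by (rule QR.AE_pair)
qed

lemma integral_coordinate:
  assumes "i \<in> V" and f: "f \<in> borel_measurable M"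
  shows "(\<integral>x. f (x i) \<partial>power_measure V) = (\<integral>s. f s \<partial>M :: real)"
  using integral_distr[OF measurable_component_singleton[OF assms(1)] f]
  unfolding distr_PiM_component[OF prob_space_axioms assms(1)] by (rule sym)

text \<open>The source of every orthogonality relation: integrate first over the coordinate \<open>k\<close>, on which
  \<open>F\<close> does not depend.\<close>

lemma integral_mult_eq_0_if_integral_coordinate_eq_0:
  assumes "finite V" "k \<in> V"
    and F: "F \<in> bounded_measurable (power_measure V)"
    and G: "G \<in> bounded_measurable (power_measure V)"
    and F_k: "\<And>x t. F (x(k := t)) = F x"
    and G_k: "\<And>x. x \<in> space (power_measure (V - {k})) \<Longrightarrow> (\<integral>t. G (x(k := t)) \<partial>M) = 0"
  shows "(\<integral>x. F x * G x \<partial>power_measure V) = 0"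
proof -
  interpret P: product_sigma_finite "\<lambda>_. M" by standard
  interpret V: prob_space "power_measure V" by (rule prob_space_power)
  have V: "insert k (V - {k}) = V" using \<open>k \<in> V\<close> by auto
  have "integrable (power_measure (insert k (V - {k}))) (\<lambda>x. F x * G x)"
    unfolding V by (rule V.integrable_bounded_measurable[OF bounded_measurable_mult[OF F G]])
  from P.product_integral_insert[OF _ _ this] \<open>finite V\<close>
  have "(\<integral>x. F x * G x \<partial>power_measure V)
      = (\<integral>x. (\<integral>t. F (x(k := t)) * G (x(k := t)) \<partial>M) \<partial>power_measure (V - {k}))"
    unfolding V by blast
  also have "\<dots> = (\<integral>x. 0 \<partial>power_measure (V - {k}))"
    by (intro Bochner_Integration.integral_cong refl) (simp add: F_k G_k)
  finally show ?thesis by simp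
qed

end

context prob_space
begin

lemma bounded_measurable_swap:
  assumes "f \<in> bounded_measurable (M \<Otimes>\<^sub>M M)"
  shows "(\<lambda>p. f (snd p, fst p)) \<in> bounded_measurable (M \<Otimes>\<^sub>M M)"
  by (rule bounded_measurable_compose[OF assms measurable_Pair[OF measurable_snd measurable_fst]])

lemma bounded_measurable_slice1:
  "f \<in> bounded_measurable (M \<Otimes>\<^sub>M M) \<Longrightarrow> x \<in> space M \<Longrightarrow> (\<lambda>y. f (x, y)) \<in> bounded_measurable M"
  by (rule bounded_measurable_compose[OF _ measurable_Pair1'])

lemma bounded_measurable_slice2:
  "f \<in> bounded_measurable (M \<Otimes>\<^sub>M M) \<Longrightarrow> y \<in> space M \<Longrightarrow> (\<lambda>x. f (x, y)) \<in> bounded_measurable M"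
  by (rule bounded_measurable_compose[OF _ measurable_Pair2'])

lemma bounded_measurable_coordinate:
  "f \<in> bounded_measurable M \<Longrightarrow> i \<in> V \<Longrightarrow> (\<lambda>x. f (x i)) \<in> bounded_measurable (power_measure V)"
  by (rule bounded_measurable_compose[OF _ measurable_component_singleton])

lemma bounded_measurable_two_coordinates:
  "f \<in> bounded_measurable (M \<Otimes>\<^sub>M M) \<Longrightarrow> i \<in> V \<Longrightarrow> j \<in> V
    \<Longrightarrow> (\<lambda>x. f (x i, x j)) \<in> bounded_measurable (power_measure V)"
  by (rule bounded_measurable_compose[OF _ measurable_two_coordinates])

section \<open>The Hoeffding decomposition of a function of two variables\<close>

definition mean :: "('a \<times> 'a \<Rightarrow> real) \<Rightarrow> real" where
  "mean f = (\<integral>p. f p \<partial>(M \<Otimes>\<^sub>M M))"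

definition row_effect :: "('a \<times> 'a \<Rightarrow> real) \<Rightarrow> 'a \<Rightarrow> real" where
  "row_effect f x = (\<integral>y. f (x, y) \<partial>M) - mean f"

definition col_effect :: "('a \<times> 'a \<Rightarrow> real) \<Rightarrow> 'a \<Rightarrow> real" where
  "col_effect f y = (\<integral>x. f (x, y) \<partial>M) - mean f"

definition interaction :: "('a \<times> 'a \<Rightarrow> real) \<Rightarrow> 'a \<times> 'a \<Rightarrow> real" where
  "interaction f p = f p - mean f - row_effect f (fst p) - col_effect f (snd p)"

lemma bounded_measurable_row_effect:
  "f \<in> bounded_measurable (M \<Otimes>\<^sub>M M) \<Longrightarrow> row_effect f \<in> bounded_measurable M"
  unfolding row_effect_def
  by (intro bounded_measurable_intros bounded_measurable_partial_integral)

lemma bounded_measurable_col_effect: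
  assumes "f \<in> bounded_measurable (M \<Otimes>\<^sub>M M)"
  shows "col_effect f \<in> bounded_measurable M"
  using bounded_measurable_partial_integral[OF bounded_measurable_swap[OF assms]]
  unfolding col_effect_def by (intro bounded_measurable_intros) simp

lemma bounded_measurable_interaction:
  assumes "f \<in> bounded_measurable (M \<Otimes>\<^sub>M M)"
  shows "interaction f \<in> bounded_measurable (M \<Otimes>\<^sub>M M)"
  unfolding interaction_def
  using assms
    bounded_measurable_compose[OF bounded_measurable_row_effect[OF assms] measurable_fst]
    bounded_measurable_compose[OF bounded_measurable_col_effect[OF assms] measurable_snd]
  by (intro bounded_measurable_intros)

lemma pair_prob_space_square: "pair_prob_space M M" ..

lemma integral_row_effect:
  assumes "f \<in> bounded_measurable (M \<Otimes>\<^sub>M M)"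
  shows "(\<integral>x. row_effect f x \<partial>M) = 0"
proof -
  interpret Q: pair_prob_space M M by (rule pair_prob_space_square)
  have "(\<integral>x. \<integral>y. f (x, y) \<partial>M \<partial>M) = mean f"
    unfolding mean_def
    by (rule Q.integral_fst'[OF Q.integrable_bounded_measurable[OF assms]])
  then show ?thesis
    unfolding row_effect_def
    by (simp add: prob_space
        integrable_bounded_measurable[OF bounded_measurable_partial_integral[OF assms]])
qed

lemma integral_col_effect:
  assumes f: "f \<in> bounded_measurable (M \<Otimes>\<^sub>M M)"
  shows "(\<integral>y. col_effect f y \<partial>M) = 0"
proof -
  interpret Q: pair_prob_space M M by (rule pair_prob_space_square)
  have "(\<integral>y. \<integral>x. f (x, y) \<partial>M \<partial>M) = mean f"
    unfolding mean_def
    using Q.integral_snd[of "\<lambda>x y. f (x, y)"] Q.integrable_bounded_measurable[OF f] by simp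
  moreover have "integrable M (\<lambda>y. \<integral>x. f (x, y) \<partial>M)"
    using integrable_bounded_measurable[OF bounded_measurable_partial_integral[OF
          bounded_measurable_swap[OF f]]] by simp
  ultimately show ?thesis
    unfolding col_effect_def by (simp add: prob_space)
qed

text \<open>The terminology is that of U-statistics: conditioning on either variable gives zero.\<close>

definition degenerate :: "('a \<times> 'a \<Rightarrow> real) \<Rightarrow> bool" where
  "degenerate h \<longleftrightarrow>
    (\<forall>x\<in>space M. (\<integral>y. h (x, y) \<partial>M) = 0) \<and> (\<forall>y\<in>space M. (\<integral>x. h (x, y) \<partial>M) = 0)"

lemma degenerate_interaction:
  assumes f: "f \<in> bounded_measurable (M \<Otimes>\<^sub>M M)"
  shows "degenerate (interaction f)"
proof -
  note int = integrable_bounded_measurable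
  have "(\<integral>y. interaction f (x, y) \<partial>M) = 0" if "x \<in> space M" for x
  proof -
    have "(\<integral>y. interaction f (x, y) \<partial>M)
        = (\<integral>y. f (x, y) \<partial>M) - mean f - row_effect f x - (\<integral>y. col_effect f y \<partial>M)"
      unfolding interaction_def
      using int[OF bounded_measurable_slice1[OF f that]]
        int[OF bounded_measurable_col_effect[OF f]]
      by (simp add: prob_space)
    then show ?thesis using integral_col_effect[OF f] by (simp add: row_effect_def)
  qed
  moreover have "(\<integral>x. interaction f (x, y) \<partial>M) = 0" if "y \<in> space M" for y
  proof -
    have "(\<integral>x. interaction f (x, y) \<partial>M)
        = (\<integral>x. f (x, y) \<partial>M) - mean f - (\<integral>x. row_effect f x \<partial>M) - col_effect f y"
      unfolding interaction_def
      using int[OF bounded_measurable_slice2[OF f that]]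
        int[OF bounded_measurable_row_effect[OF f]]
      by (simp add: prob_space)
    then show ?thesis using integral_row_effect[OF f] by (simp add: col_effect_def)
  qed
  ultimately show ?thesis by (simp add: degenerate_def)
qed

lemma orthogonal_coordinates:
  assumes "finite V" "v \<in> V" "w \<in> V" "v \<noteq> w"
    and g: "g \<in> bounded_measurable M" and h: "h \<in> bounded_measurable M"
    and "(\<integral>t. h t \<partial>M) = 0"
  shows "(\<integral>x. g (x v) * h (x w) \<partial>power_measure V) = 0"
  by (rule integral_mult_eq_0_if_integral_coordinate_eq_0[where k = w])
     (use assms in \<open>auto intro: bounded_measurable_coordinate\<close>)

lemma orthogonal_degenerate:
  assumes "finite V" "i \<in> V" "j \<in> V" "i \<noteq> j" "k = i \<or> k = j"
    and F: "F \<in> bounded_measurable (power_measure V)" and "\<And>x t. F (x(k := t)) = F x"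
    and h: "h \<in> bounded_measurable (M \<Otimes>\<^sub>M M)" "degenerate h"
  shows "(\<integral>x. F x * h (x i, x j) \<partial>power_measure V) = 0"
proof (rule integral_mult_eq_0_if_integral_coordinate_eq_0[where k = k])
  fix x assume "x \<in> space (power_measure (V - {k}))"
  then have "x l \<in> space M" if "l \<in> V - {k}" for l
    using that by (auto simp: space_PiM PiE_iff)
  with assms(2-5) h(2)
  show "(\<integral>t. h ((x(k := t)) i, (x(k := t)) j) \<partial>M) = 0"
    by (auto simp: degenerate_def)
qed (use assms in \<open>auto intro: bounded_measurable_two_coordinates\<close>)

text \<open>At least one of \<open>i\<close> and \<open>j\<close> differs from \<open>v\<close>; integrate over that coordinate.\<close>

lemma orthogonal_coordinate_degenerate:
  assumes "finite V" "i \<in> V" "j \<in> V" "i \<noteq> j" "v \<in> V"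
    and g: "g \<in> bounded_measurable M"
    and h: "h \<in> bounded_measurable (M \<Otimes>\<^sub>M M)" "degenerate h"
  shows "(\<integral>x. g (x v) * h (x i, x j) \<partial>power_measure V) = 0"
proof (rule orthogonal_degenerate)
  show "(if v = i then j else i) = i \<or> (if v = i then j else i) = j" by simp
  show "g ((x((if v = i then j else i) := t)) v) = g (x v)" for x t
    using \<open>i \<noteq> j\<close> by simp
qed (use assms in \<open>auto intro: bounded_measurable_coordinate\<close>)

text \<open>The square is viewed as the cube indexed by the two truth values, so that the orthogonality
  relations for cubes apply.\<close>

lemma integral_square_Hoeffding:
  assumes f: "f \<in> bounded_measurable (M \<Otimes>\<^sub>M M)"
  shows "(\<integral>p. (f p - mean f)\<^sup>2 \<partial>(M \<Otimes>\<^sub>M M))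
    = (\<integral>x. (row_effect f x)\<^sup>2 \<partial>M) + (\<integral>y. (col_effect f y)\<^sup>2 \<partial>M)
      + (\<integral>p. (interaction f p)\<^sup>2 \<partial>(M \<Otimes>\<^sub>M M))"
proof -
  let ?P = "power_measure (UNIV :: bool set)"
  let ?a = "row_effect f" and ?b = "col_effect f" and ?c = "interaction f"
  interpret P: prob_space ?P by (rule prob_space_power)
  note a = bounded_measurable_row_effect[OF f] and b = bounded_measurable_col_effect[OF f]
    and c = bounded_measurable_interaction[OF f]
  note a' = bounded_measurable_coordinate[OF a UNIV_I, of False]
    and b' = bounded_measurable_coordinate[OF b UNIV_I, of True]
    and c' = bounded_measurable_two_coordinates[OF c UNIV_I UNIV_I, of False True]
  have ab: "(\<integral>x. ?a (x False) * ?b (x True) \<partial>?P) = 0"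
    using a b integral_col_effect[OF f] by (intro orthogonal_coordinates) auto
  have ac: "(\<integral>x. ?a (x False) * ?c (x False, x True) \<partial>?P) = 0"
    using a c degenerate_interaction[OF f] by (intro orthogonal_coordinate_degenerate) auto
  have bc: "(\<integral>x. ?b (x True) * ?c (x False, x True) \<partial>?P) = 0"
    using b c degenerate_interaction[OF f] by (intro orthogonal_coordinate_degenerate) auto
  have "(\<integral>p. (f p - mean f)\<^sup>2 \<partial>(M \<Otimes>\<^sub>M M))
      = (\<integral>x. (f (x False, x True) - mean f)\<^sup>2 \<partial>?P)"
    by (rule integral_two_coordinates[symmetric])
       (auto intro!: bounded_measurable_borel bounded_measurable_intros f)
  also have "\<dots> = (\<integral>x. (?a (x False))\<^sup>2 + (?b (x True))\<^sup>2 + (?c (x False, x True))\<^sup>2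
      + 2 * (?a (x False) * ?b (x True)) + 2 * (?a (x False) * ?c (x False, x True))
      + 2 * (?b (x True) * ?c (x False, x True)) \<partial>?P)"
  proof (rule Bochner_Integration.integral_cong[OF refl])
    fix x
    have "f (x False, x True) - mean f = ?a (x False) + ?b (x True) + ?c (x False, x True)"
      by (simp add: interaction_def)
    then show "(f (x False, x True) - mean f)\<^sup>2
        = (?a (x False))\<^sup>2 + (?b (x True))\<^sup>2 + (?c (x False, x True))\<^sup>2
          + 2 * (?a (x False) * ?b (x True)) + 2 * (?a (x False) * ?c (x False, x True))
          + 2 * (?b (x True) * ?c (x False, x True))"
      by (simp add: power2_eq_square algebra_simps)
  qed
  also have "\<dots> = (\<integral>x. (?a (x False))\<^sup>2 \<partial>?P) + (\<integral>x. (?b (x True))\<^sup>2 \<partial>?P)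
      + (\<integral>x. (?c (x False, x True))\<^sup>2 \<partial>?P)"
    using P.integrable_bounded_measurable[OF bounded_measurable_power2[OF a']]
      P.integrable_bounded_measurable[OF bounded_measurable_power2[OF b']]
      P.integrable_bounded_measurable[OF bounded_measurable_power2[OF c']]
      P.integrable_bounded_measurable[OF bounded_measurable_mult[OF a' b']]
      P.integrable_bounded_measurable[OF bounded_measurable_mult[OF a' c']]
      P.integrable_bounded_measurable[OF bounded_measurable_mult[OF b' c']]
    by (simp add: ab ac bc)
  also have "(\<integral>x. (?a (x False))\<^sup>2 \<partial>?P) = (\<integral>s. (?a s)\<^sup>2 \<partial>M)"
    by (rule integral_coordinate) (auto intro!: bounded_measurable_borel bounded_measurable_power2 a)
  also have "(\<integral>x. (?b (x True))\<^sup>2 \<partial>?P) = (\<integral>s. (?b s)\<^sup>2 \<partial>M)"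
    by (rule integral_coordinate) (auto intro!: bounded_measurable_borel bounded_measurable_power2 b)
  also have "(\<integral>x. (?c (x False, x True))\<^sup>2 \<partial>?P) = (\<integral>p. (?c p)\<^sup>2 \<partial>(M \<Otimes>\<^sub>M M))"
    by (rule integral_two_coordinates)
       (auto intro!: bounded_measurable_borel bounded_measurable_power2 c)
  finally show ?thesis .
qed

end

section \<open>Degrees\<close>

lemma (in fin_digraph) sum_arcs_tail:
  "(\<Sum>e\<in>arcs G. a (tail G e)) = (\<Sum>v\<in>verts G. real (out_degree G v) * a v)"
proof -
  have "(\<Sum>v\<in>verts G. \<Sum>e\<in>{e \<in> arcs G. tail G e = v}. a (tail G e)) = (\<Sum>e\<in>arcs G. a (tail G e))"
    by (rule sum.group) auto
  moreover have "(\<Sum>e\<in>{e \<in> arcs G. tail G e = v}. a (tail G e)) = real (out_degree G v) * a v" for v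
    by (simp add: out_degree_def out_arcs_def)
  ultimately show ?thesis by (simp only:)
qed

lemma (in fin_digraph) sum_arcs_head:
  "(\<Sum>e\<in>arcs G. a (head G e)) = (\<Sum>v\<in>verts G. real (in_degree G v) * a v)"
proof -
  have "(\<Sum>v\<in>verts G. \<Sum>e\<in>{e \<in> arcs G. head G e = v}. a (head G e)) = (\<Sum>e\<in>arcs G. a (head G e))"
    by (rule sum.group) auto
  moreover have "(\<Sum>e\<in>{e \<in> arcs G. head G e = v}. a (head G e)) = real (in_degree G v) * a v" for v
    by (simp add: in_degree_def in_arcs_def)
  ultimately show ?thesis by (simp only:)
qed

definition degree_form :: "('v, 'e) pre_digraph \<Rightarrow> real \<Rightarrow> real \<Rightarrow> real" where
  "degree_form D \<xi> \<beta>
    = (\<Sum>v\<in>verts D. (real (out_degree D v) * \<xi> + real (in_degree D v) * \<beta>)\<^sup>2)"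

lemma degree_form_nonneg: "0 \<le> degree_form D \<xi> \<beta>"
  unfolding degree_form_def by (intro sum_nonneg) auto

lemma degree_gap_eq:
  "degree_gap D
    = (INF p \<in> UNIV - {(0, 0)}. degree_form D (fst p) (snd p) / ((fst p)\<^sup>2 + (snd p)\<^sup>2))"
  unfolding degree_gap_def degree_form_def by (simp add: case_prod_unfold)

lemma degree_gap_le_degree_form: "degree_gap D * (\<xi>\<^sup>2 + \<beta>\<^sup>2) \<le> degree_form D \<xi> \<beta>"
proof (cases "(\<xi>, \<beta>) = (0, 0)")
  case False
  then have pos: "0 < \<xi>\<^sup>2 + \<beta>\<^sup>2" by (auto simp: sum_power2_gt_zero_iff)
  have "degree_gap D \<le> degree_form D (fst (\<xi>, \<beta>)) (snd (\<xi>, \<beta>)) / ((fst (\<xi>, \<beta>))\<^sup>2 + (snd (\<xi>, \<beta>))\<^sup>2)"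
    unfolding degree_gap_eq
    by (rule cINF_lower) (use False in \<open>auto intro!: bdd_belowI2[where m = 0] divide_nonneg_nonneg degree_form_nonneg\<close>)
  with pos show ?thesis by (simp add: field_simps)
qed (simp add: degree_form_nonneg)

lemma degree_form_scale: "degree_form D (c * \<xi>) (c * \<beta>) = c\<^sup>2 * degree_form D \<xi> \<beta>"
proof -
  have "(a * (c * \<xi>) + b * (c * \<beta>))\<^sup>2 = c\<^sup>2 * (a * \<xi> + b * \<beta>)\<^sup>2" for a b :: real
    by (simp add: power2_eq_square algebra_simps)
  then show ?thesis by (simp add: degree_form_def sum_distrib_left)
qed

lemma degree_form_pos:
  assumes D: "fin_digraph D" and "\<not> eulerian D" and "arcs D \<noteq> {}" and nz: "(\<xi>, \<beta>) \<noteq> (0, 0)"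
  shows "0 < degree_form D \<xi> \<beta>"
proof (rule ccontr)
  interpret fin_digraph D by fact
  assume "\<not> 0 < degree_form D \<xi> \<beta>"
  then have "degree_form D \<xi> \<beta> = 0" using degree_form_nonneg[of D \<xi> \<beta>] by linarith
  then have zero: "real (out_degree D v) * \<xi> + real (in_degree D v) * \<beta> = 0" if "v \<in> verts D" for v
    using that by (simp add: degree_form_def sum_nonneg_eq_0_iff)
  have "real (card (arcs D)) * (\<xi> + \<beta>)
      = (\<Sum>v\<in>verts D. real (out_degree D v) * \<xi> + real (in_degree D v) * \<beta>)"
    using sum_arcs_tail[of "\<lambda>_. \<xi>"] sum_arcs_head[of "\<lambda>_. \<beta>"]
    by (simp add: sum.distrib distrib_left)
  also have "\<dots> = 0" by (simp add: zero)
  finally have \<beta>: "\<beta> = - \<xi>" using \<open>arcs D \<noteq> {}\<close> by auto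
  obtain v where v: "v \<in> verts D" "out_degree D v \<noteq> in_degree D v"
    using \<open>\<not> eulerian D\<close> by (auto simp: eulerian_def)
  have "(real (out_degree D v) - real (in_degree D v)) * \<xi> = 0"
    using zero[OF v(1)] by (simp add: \<beta> algebra_simps)
  then show False using v(2) nz \<beta> by auto
qed

text \<open>By homogeneity the infimum is taken over the unit circle, where it is attained.\<close>

lemma degree_gap_pos:
  assumes "fin_digraph D" "\<not> eulerian D" "arcs D \<noteq> {}"
  shows "0 < degree_gap D"
proof -
  let ?q = "\<lambda>p. degree_form D (fst p) (snd p)"
  have "\<exists>p\<in>sphere 0 1. \<forall>p'\<in>sphere 0 1. ?q p \<le> ?q p'"
  proof (rule continuous_attains_inf)
    show "sphere (0 :: real \<times> real) 1 \<noteq> {}"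
      by (rule ex_in_conv[THEN iffD1], rule exI[where x = "(1, 0)"]) (simp add: norm_Pair)
    show "continuous_on (sphere (0 :: real \<times> real) 1) ?q"
      unfolding degree_form_def by (intro continuous_intros)
  qed simp
  then obtain p where "p \<in> sphere 0 1" and "\<forall>p'\<in>sphere 0 1. ?q p \<le> ?q p'"
    by blast
  then have p: "norm p = 1" and min: "norm p' = 1 \<Longrightarrow> ?q p \<le> ?q p'" for p'
    by simp_all
  have "0 < ?q p"
    using p by (intro degree_form_pos[OF assms]) (auto simp: norm_Pair)
  moreover have "?q p \<le> degree_gap D"
    unfolding degree_gap_eq
  proof (rule cINF_greatest)
    fix r :: "real \<times> real" assume "r \<in> UNIV - {(0, 0)}"
    then have r: "0 < norm r" by (simp add: zero_prod_def)
    have "?q p \<le> ?q ((1 / norm r) *\<^sub>R r)"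
      using r by (intro min) simp
    also have "\<dots> = ?q r / (norm r)\<^sup>2"
      using degree_form_scale[of D "1 / norm r" "fst r" "snd r"]
      by (simp add: power_divide)
    also have "(norm r)\<^sup>2 = (fst r)\<^sup>2 + (snd r)\<^sup>2"
      by (simp add: norm_prod_def)
    finally show "?q p \<le> ?q r / ((fst r)\<^sup>2 + (snd r)\<^sup>2)" .
  qed (metis DiffI UNIV_I empty_iff prod.inject singletonD zero_neq_one)
  ultimately show ?thesis by linarith
qed

section \<open>The variance of an arc sum\<close>

definition arc_sum :: "('v, 'e) pre_digraph \<Rightarrow> ('a \<times> 'a \<Rightarrow> real) \<Rightarrow> ('v \<Rightarrow> 'a) \<Rightarrow> real" where
  "arc_sum D f x = (\<Sum>e\<in>arcs D. f (x (tail D e), x (head D e)))"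

text \<open>Otherwise \<open>e\<close> and \<open>e'\<close> would have the same two endpoints and be parallel or opposite.\<close>

lemma private_endpoint:
  assumes "oriented_graph D" "e \<in> arcs D" "e' \<in> arcs D" "e \<noteq> e'"
  obtains k where "k = tail D e' \<or> k = head D e'" "k \<noteq> tail D e" "k \<noteq> head D e"
proof -
  interpret digraph D using assms(1) by (simp add: oriented_graph_def)
  have "(tail D e, head D e) \<noteq> (tail D e', head D e')"
    using no_multi_arcs[OF assms(2,3)] assms(4) by (auto simp: arc_to_ends_def)
  moreover have "\<not> (tail D e = head D e' \<and> head D e = tail D e')"
    using assms by (auto simp: oriented_graph_def)
  moreover have "tail D e' \<noteq> head D e'" using no_loops[OF assms(3)] .
  ultimately have "(tail D e' \<noteq> tail D e \<and> tail D e' \<noteq> head D e)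
      \<or> (head D e' \<noteq> tail D e \<and> head D e' \<noteq> head D e)"
    by auto
  then show ?thesis using that by blast
qed

context prob_space
begin

lemma bounded_measurable_arc_sum:
  assumes D: "oriented_graph D" and f: "f \<in> bounded_measurable (M \<Otimes>\<^sub>M M)"
  shows "arc_sum D f \<in> bounded_measurable (power_measure (verts D))"
proof -
  interpret digraph D using D by (simp add: oriented_graph_def)
  show ?thesis
    unfolding arc_sum_def
    by (intro bounded_measurable_sum bounded_measurable_two_coordinates f) auto
qed

text \<open>The identity behind the degree gap. A vertex \<open>v\<close> is the tail of \<open>d\<^sup>+(v)\<close> arcs and the head of
  \<open>d\<^sup>-(v)\<close> arcs, so the row and column effects of all arcs at \<open>v\<close> add up to one function of \<open>x v\<close>,
  while the interactions of distinct arcs stay uncorrelated.\<close>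

lemma variance_arc_sum:
  fixes D :: "('v, 'e) pre_digraph"
  assumes D: "oriented_graph D" and f: "f \<in> bounded_measurable (M \<Otimes>\<^sub>M M)"
  shows "(\<integral>x. (arc_sum D f x - real (card (arcs D)) * mean f)\<^sup>2 \<partial>power_measure (verts D))
    = (\<integral>s. degree_form D (row_effect f s) (col_effect f s) \<partial>M)
      + real (card (arcs D)) * (\<integral>p. (interaction f p)\<^sup>2 \<partial>(M \<Otimes>\<^sub>M M))"
proof -
  interpret digraph D using D by (simp add: oriented_graph_def)
  let ?P = "power_measure (verts D)"
  interpret P: prob_space ?P by (rule prob_space_power)
  define c where "c = interaction f"
  define g where "g v s = real (out_degree D v) * row_effect f s
      + real (in_degree D v) * col_effect f s" for v s
  define G where "G x = (\<Sum>v\<in>verts D. g v (x v))" for x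
  note row = bounded_measurable_row_effect[OF f] and col = bounded_measurable_col_effect[OF f]
  have c: "c \<in> bounded_measurable (M \<Otimes>\<^sub>M M)" "degenerate c"
    unfolding c_def
    using bounded_measurable_interaction[OF f] degenerate_interaction[OF f] by auto
  have g: "g v \<in> bounded_measurable M" for v
    unfolding g_def by (intro bounded_measurable_intros row col)
  have gv: "(\<lambda>x. g v (x v)) \<in> bounded_measurable ?P" if "v \<in> verts D" for v
    by (rule bounded_measurable_coordinate[OF g that])
  have ce: "(\<lambda>x. c (x (tail D e), x (head D e))) \<in> bounded_measurable ?P" if "e \<in> arcs D" for e
    using that by (intro bounded_measurable_two_coordinates c) auto
  have g0: "(\<integral>s. g v s \<partial>M) = 0" for v
    unfolding g_def
    using integrable_bounded_measurable[OF row] integrable_bounded_measurable[OF col]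
    by (simp add: integral_row_effect[OF f] integral_col_effect[OF f])
  have G: "G \<in> bounded_measurable ?P"
    unfolding G_def by (intro bounded_measurable_sum gv)
  have H: "arc_sum D c \<in> bounded_measurable ?P"
    by (rule bounded_measurable_arc_sum[OF D c(1)])
  have GG: "(\<integral>x. (G x)\<^sup>2 \<partial>?P) = (\<integral>s. degree_form D (row_effect f s) (col_effect f s) \<partial>M)"
  proof -
    have "(\<integral>x. (G x)\<^sup>2 \<partial>?P) = (\<Sum>v\<in>verts D. \<integral>x. (g v (x v))\<^sup>2 \<partial>?P)"
      unfolding G_def
      by (rule P.integral_square_sum_orthogonal)
         (auto intro: gv orthogonal_coordinates g g0)
    also have "\<dots> = (\<Sum>v\<in>verts D. \<integral>s. (g v s)\<^sup>2 \<partial>M)"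
      by (intro sum.cong refl integral_coordinate bounded_measurable_borel
          bounded_measurable_power2 g)
    also have "\<dots> = (\<integral>s. (\<Sum>v\<in>verts D. (g v s)\<^sup>2) \<partial>M)"
      by (intro Bochner_Integration.integral_sum[symmetric] integrable_bounded_measurable
          bounded_measurable_power2 g)
    finally show ?thesis by (simp add: g_def degree_form_def)
  qed
  have HH: "(\<integral>x. (arc_sum D c x)\<^sup>2 \<partial>?P)
      = real (card (arcs D)) * (\<integral>p. (c p)\<^sup>2 \<partial>(M \<Otimes>\<^sub>M M))"
  proof -
    have "(\<integral>x. (arc_sum D c x)\<^sup>2 \<partial>?P)
        = (\<Sum>e\<in>arcs D. \<integral>x. (c (x (tail D e), x (head D e)))\<^sup>2 \<partial>?P)"
      unfolding arc_sum_def
    proof (rule P.integral_square_sum_orthogonal)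
      fix e e' assume e: "e \<in> arcs D" "e' \<in> arcs D" "e \<noteq> e'"
      obtain k where k: "k = tail D e' \<or> k = head D e'" "k \<noteq> tail D e" "k \<noteq> head D e"
        using private_endpoint[OF D e] .
      show "(\<integral>x. c (x (tail D e), x (head D e)) * c (x (tail D e'), x (head D e')) \<partial>?P) = 0"
        by (rule orthogonal_degenerate[OF _ _ _ _ k(1) ce[OF e(1)] _ c])
           (use e k no_loops in auto)
    qed (auto intro: ce)
    also have "\<dots> = (\<Sum>e\<in>arcs D. \<integral>p. (c p)\<^sup>2 \<partial>(M \<Otimes>\<^sub>M M))"
      using no_loops
      by (intro sum.cong refl integral_two_coordinates bounded_measurable_borel
          bounded_measurable_power2 c) auto
    finally show ?thesis by simp
  qed
  have GH: "(\<integral>x. G x * arc_sum D c x \<partial>?P) = 0"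
  proof -
    have "(\<integral>x. G x * arc_sum D c x \<partial>?P)
        = (\<integral>x. (\<Sum>v\<in>verts D. \<Sum>e\<in>arcs D. g v (x v) * c (x (tail D e), x (head D e))) \<partial>?P)"
      by (simp add: G_def arc_sum_def sum_product)
    also have "\<dots> = (\<Sum>v\<in>verts D. \<Sum>e\<in>arcs D.
        \<integral>x. g v (x v) * c (x (tail D e), x (head D e)) \<partial>?P)"
      using P.integrable_bounded_measurable[OF bounded_measurable_mult[OF gv ce]]
      by (simp add: Bochner_Integration.integral_sum)
    also have "\<dots> = (\<Sum>v\<in>verts D. \<Sum>e\<in>arcs D. 0)"
      using no_loops
      by (intro sum.cong refl orthogonal_coordinate_degenerate g c) auto
    finally show ?thesis by simp
  qed
  \<comment> \<open>\<open>G\<close> collects the one-variable terms by vertices; the interactions remain indexed by arcs.\<close>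
  have "arc_sum D f x - real (card (arcs D)) * mean f = G x + arc_sum D c x" for x
  proof -
    have "arc_sum D f x = (\<Sum>e\<in>arcs D. mean f + row_effect f (x (tail D e))
        + col_effect f (x (head D e)) + c (x (tail D e), x (head D e)))"
      unfolding arc_sum_def by (intro sum.cong refl) (simp add: c_def interaction_def)
    also have "\<dots> = real (card (arcs D)) * mean f + (\<Sum>e\<in>arcs D. row_effect f (x (tail D e)))
        + (\<Sum>e\<in>arcs D. col_effect f (x (head D e))) + arc_sum D c x"
      by (simp add: sum.distrib arc_sum_def)
    also have "(\<Sum>e\<in>arcs D. row_effect f (x (tail D e)))
        = (\<Sum>v\<in>verts D. real (out_degree D v) * row_effect f (x v))"
      by (rule sum_arcs_tail)
    also have "(\<Sum>e\<in>arcs D. col_effect f (x (head D e)))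
        = (\<Sum>v\<in>verts D. real (in_degree D v) * col_effect f (x v))"
      by (rule sum_arcs_head)
    finally show ?thesis by (simp add: G_def g_def sum.distrib)
  qed
  then have "(\<integral>x. (arc_sum D f x - real (card (arcs D)) * mean f)\<^sup>2 \<partial>?P)
      = (\<integral>x. (G x)\<^sup>2 + (arc_sum D c x)\<^sup>2 + 2 * (G x * arc_sum D c x) \<partial>?P)"
    by (simp add: power2_sum mult.assoc)
  also have "\<dots> = (\<integral>x. (G x)\<^sup>2 \<partial>?P) + (\<integral>x. (arc_sum D c x)\<^sup>2 \<partial>?P)"
    using P.integrable_bounded_measurable[OF bounded_measurable_power2[OF G]]
      P.integrable_bounded_measurable[OF bounded_measurable_power2[OF H]]
      P.integrable_bounded_measurable[OF bounded_measurable_mult[OF G H]]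
    by (simp add: GH)
  finally show ?thesis unfolding GG HH unfolding c_def .
qed

text \<open>Compare the two orthogonal decompositions term by term.\<close>

lemma square_distance_le_variance_arc_sum:
  assumes D: "oriented_graph D" "\<not> eulerian D" "arcs D \<noteq> {}"
    and f: "f \<in> bounded_measurable (M \<Otimes>\<^sub>M M)"
  shows "(\<integral>p. (f p - mean f)\<^sup>2 \<partial>(M \<Otimes>\<^sub>M M))
    \<le> max (1 / degree_gap D) (1 / real (card (arcs D)))
      * (\<integral>x. (arc_sum D f x - real (card (arcs D)) * mean f)\<^sup>2 \<partial>power_measure (verts D))"
proof -
  interpret digraph D using D by (simp add: oriented_graph_def)
  let ?\<gamma> = "degree_gap D" and ?m = "real (card (arcs D))"
  define A where "A = (\<integral>s. (row_effect f s)\<^sup>2 + (col_effect f s)\<^sup>2 \<partial>M)"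
  define B where "B = (\<integral>s. degree_form D (row_effect f s) (col_effect f s) \<partial>M)"
  define C where "C = (\<integral>p. (interaction f p)\<^sup>2 \<partial>(M \<Otimes>\<^sub>M M))"
  note row = bounded_measurable_row_effect[OF f] and col = bounded_measurable_col_effect[OF f]
  have \<gamma>: "0 < ?\<gamma>" by (rule degree_gap_pos[OF _ D(2,3)]) unfold_locales
  have "?\<gamma> * A \<le> B"
  proof -
    have "(\<integral>s. ?\<gamma> * ((row_effect f s)\<^sup>2 + (col_effect f s)\<^sup>2) \<partial>M) \<le> B"
      unfolding B_def
    proof (intro integral_mono integrable_bounded_measurable)
      show "(\<lambda>s. ?\<gamma> * ((row_effect f s)\<^sup>2 + (col_effect f s)\<^sup>2)) \<in> bounded_measurable M"
        by (intro bounded_measurable_intros row col)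
      show "(\<lambda>s. degree_form D (row_effect f s) (col_effect f s)) \<in> bounded_measurable M"
        unfolding degree_form_def by (intro bounded_measurable_intros row col)
    qed (rule degree_gap_le_degree_form)
    then show ?thesis by (simp add: A_def)
  qed
  then have "A \<le> 1 / ?\<gamma> * B" using \<gamma> by (simp add: field_simps)
  also have "\<dots> \<le> max (1 / ?\<gamma>) (1 / ?m) * B"
    by (intro mult_right_mono) (auto simp: B_def intro: Bochner_Integration.integral_nonneg degree_form_nonneg)
  finally have A: "A \<le> max (1 / ?\<gamma>) (1 / ?m) * B" .
  have "C = 1 / ?m * (?m * C)" using D(3) by simp
  also have "\<dots> \<le> max (1 / ?\<gamma>) (1 / ?m) * (?m * C)"
    by (intro mult_right_mono) (auto simp: C_def)
  finally have C: "C \<le> max (1 / ?\<gamma>) (1 / ?m) * (?m * C)" .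
  have "(\<integral>p. (f p - mean f)\<^sup>2 \<partial>(M \<Otimes>\<^sub>M M)) = A + C"
    using integrable_bounded_measurable[OF bounded_measurable_power2[OF row]]
      integrable_bounded_measurable[OF bounded_measurable_power2[OF col]]
    by (simp add: integral_square_Hoeffding[OF f] A_def C_def)
  also have "\<dots> \<le> max (1 / ?\<gamma>) (1 / ?m) * (B + ?m * C)"
    using A C by (simp add: distrib_left)
  finally show ?thesis
    by (simp add: variance_arc_sum[OF D(1) f] B_def C_def)
qed

end

section \<open>The covariance of an arc sum with its exponential\<close>

text \<open>The mean value theorem with the smallest slope; for \<open>y \<le> x\<close> it is
  \<open>exp x - exp y = exp y * (exp (x - y) - 1) \<ge> exp (- L) * (x - y)\<close>.\<close>

lemma exp_strongly_monotone:
  fixes x y L :: real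
  assumes "- L \<le> x" "- L \<le> y"
  shows "exp (- L) * (x - y)\<^sup>2 \<le> (exp x - exp y) * (x - y)"
proof -
  have *: "exp (- L) * (u - v)\<^sup>2 \<le> (exp u - exp v) * (u - v)" if "v \<le> u" "- L \<le> v" for u v :: real
  proof -
    have "u - v \<le> exp (u - v) - 1"
      using exp_ge_add_one_self[of "u - v"] by linarith
    then have "exp (- L) * (u - v) \<le> exp v * (exp (u - v) - 1)"
      using that by (intro mult_mono) auto
    also have "\<dots> = exp u - exp v"
      by (simp add: right_diff_distrib exp_diff)
    finally have "exp (- L) * (u - v) * (u - v) \<le> (exp u - exp v) * (u - v)"
      using that by (intro mult_right_mono) auto
    then show ?thesis by (simp only: power2_eq_square mult.assoc)
  qed
  show ?thesis
    using *[of x y] *[of y x] assms by (cases "y \<le> x") (auto simp: power2_commute algebra_simps)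
qed

context prob_space
begin

text \<open>The homomorphism density of the kernel \<open>exp f\<close> over an arbitrary probability space, without
  completion; its arc-rooted densities and discrepancy are defined in the same setting.\<close>

definition exp_density :: "('v, 'e) pre_digraph \<Rightarrow> ('a \<times> 'a \<Rightarrow> real) \<Rightarrow> real" where
  "exp_density D f = (\<integral>x. exp (arc_sum D f x) \<partial>power_measure (verts D))"

definition exp_rooted_density ::
  "('v, 'e) pre_digraph \<Rightarrow> ('a \<times> 'a \<Rightarrow> real) \<Rightarrow> 'e \<Rightarrow> 'a \<times> 'a \<Rightarrow> real" where
  "exp_rooted_density D f e p = (\<integral>z. exp (arc_sum D f (insert_pair (tail D e) (head D e) (p, z)))
     \<partial>power_measure (verts D - {tail D e, head D e}))"

lemma integral_arc_sum:
  assumes D: "oriented_graph D" and f: "f \<in> bounded_measurable (M \<Otimes>\<^sub>M M)"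
  shows "(\<integral>x. arc_sum D f x \<partial>power_measure (verts D)) = real (card (arcs D)) * mean f"
proof -
  interpret digraph D using D by (simp add: oriented_graph_def)
  interpret P: prob_space "power_measure (verts D)" by (rule prob_space_power)
  have "(\<integral>x. arc_sum D f x \<partial>power_measure (verts D))
      = (\<Sum>e\<in>arcs D. \<integral>x. f (x (tail D e), x (head D e)) \<partial>power_measure (verts D))"
    unfolding arc_sum_def
    by (intro Bochner_Integration.integral_sum P.integrable_bounded_measurable
        bounded_measurable_two_coordinates f) auto
  also have "\<dots> = (\<Sum>e\<in>arcs D. mean f)"
    unfolding mean_def using no_loops
    by (intro sum.cong refl integral_two_coordinates bounded_measurable_borel f) auto
  finally show ?thesis by simp
qed

lemma bounded_measurable_exp_rooted_density:
  assumes D: "oriented_graph D" and f: "f \<in> bounded_measurable (M \<Otimes>\<^sub>M M)" and e: "e \<in> arcs D"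
  shows "exp_rooted_density D f e \<in> bounded_measurable (M \<Otimes>\<^sub>M M)"
proof -
  interpret digraph D using D by (simp add: oriented_graph_def)
  interpret R: prob_space "power_measure (verts D - {tail D e, head D e})"
    by (rule prob_space_power)
  show ?thesis
    unfolding exp_rooted_density_def
    using e by (intro R.bounded_measurable_partial_integral bounded_measurable_exp
        bounded_measurable_compose[OF bounded_measurable_arc_sum[OF D f] measurable_insert_pair])
       auto
qed

lemma integral_exp_arc_sum_mult:
  assumes D: "oriented_graph D" and f: "f \<in> bounded_measurable (M \<Otimes>\<^sub>M M)" and e: "e \<in> arcs D"
    and h: "h \<in> bounded_measurable (M \<Otimes>\<^sub>M M)"
  shows "(\<integral>x. exp (arc_sum D f x) * h (x (tail D e), x (head D e)) \<partial>power_measure (verts D))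
    = (\<integral>p. exp_rooted_density D f e p * h p \<partial>(M \<Otimes>\<^sub>M M))"
proof -
  interpret digraph D using D by (simp add: oriented_graph_def)
  let ?i = "tail D e" and ?j = "head D e"
  have ij: "?i \<in> verts D" "?j \<in> verts D" "?i \<noteq> ?j"
    using e no_loops by auto
  have "(\<integral>x. exp (arc_sum D f x) * h (x ?i, x ?j) \<partial>power_measure (verts D))
      = (\<integral>p. (\<integral>z. exp (arc_sum D f (insert_pair ?i ?j (p, z)))
            * h (insert_pair ?i ?j (p, z) ?i, insert_pair ?i ?j (p, z) ?j)
          \<partial>power_measure (verts D - {?i, ?j})) \<partial>(M \<Otimes>\<^sub>M M))"
    by (intro integral_insert_pair bounded_measurable_mult bounded_measurable_exp
        bounded_measurable_arc_sum[OF D f] bounded_measurable_two_coordinates[OF h] ij finite_verts)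
  also have "\<dots> = (\<integral>p. exp_rooted_density D f e p * h p \<partial>(M \<Otimes>\<^sub>M M))"
    using ij(3) by (simp add: insert_pair_def exp_rooted_density_def)
  finally show ?thesis .
qed

text \<open>Because \<open>h\<close> is centred, the constant \<open>t\<close> may be subtracted from the rooted density.\<close>

lemma integral_exp_rooted_density_mult_le:
  assumes D: "oriented_graph D" and f: "f \<in> bounded_measurable (M \<Otimes>\<^sub>M M)" and e: "e \<in> arcs D"
    and h: "h \<in> bounded_measurable (M \<Otimes>\<^sub>M M)" "(\<integral>p. h p \<partial>(M \<Otimes>\<^sub>M M)) = 0"
    and K: "\<And>p. p \<in> space (M \<Otimes>\<^sub>M M) \<Longrightarrow> \<bar>h p\<bar> \<le> K" and t: "0 < t"
  shows "(\<integral>p. exp_rooted_density D f e p * h p \<partial>(M \<Otimes>\<^sub>M M))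
    \<le> t * K * (\<integral>p. \<bar>exp_rooted_density D f e p / t - 1\<bar> \<partial>(M \<Otimes>\<^sub>M M))"
proof -
  interpret Q: prob_space "M \<Otimes>\<^sub>M M" by (rule prob_space_square)
  let ?r = "exp_rooted_density D f e"
  note r = bounded_measurable_exp_rooted_density[OF D f e]
  have q: "(\<lambda>p. ?r p / t - 1) \<in> bounded_measurable (M \<Otimes>\<^sub>M M)"
    using bounded_measurable_diff[OF bounded_measurable_mult[OF r bounded_measurable_const[of "1 / t"]]
        bounded_measurable_const[of 1]] by simp
  have "(\<integral>p. ?r p * h p \<partial>(M \<Otimes>\<^sub>M M)) = (\<integral>p. ?r p * h p - t * h p \<partial>(M \<Otimes>\<^sub>M M))"
    using Q.integrable_bounded_measurable[OF bounded_measurable_mult[OF r h(1)]]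
      Q.integrable_bounded_measurable[OF h(1)] h(2) by simp
  also have "\<dots> \<le> (\<integral>p. t * K * \<bar>?r p / t - 1\<bar> \<partial>(M \<Otimes>\<^sub>M M))"
  proof (rule integral_mono)
    show "integrable (M \<Otimes>\<^sub>M M) (\<lambda>p. ?r p * h p - t * h p)"
      by (intro Q.integrable_bounded_measurable bounded_measurable_intros r h)
    show "integrable (M \<Otimes>\<^sub>M M) (\<lambda>p. t * K * \<bar>?r p / t - 1\<bar>)"
      using Q.integrable_bounded_measurable[OF q] by simp
    fix p assume p: "p \<in> space (M \<Otimes>\<^sub>M M)"
    have "?r p * h p - t * h p = t * ((?r p / t - 1) * h p)"
      using t by (simp add: field_simps)
    also have "\<dots> \<le> t * (\<bar>?r p / t - 1\<bar> * \<bar>h p\<bar>)"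
      using t by (intro mult_left_mono) (auto simp: abs_mult[symmetric])
    also have "\<dots> \<le> t * (\<bar>?r p / t - 1\<bar> * K)"
      using t K[OF p] by (intro mult_left_mono) auto
    finally show "?r p * h p - t * h p \<le> t * K * \<bar>?r p / t - 1\<bar>"
      by (simp add: mult_ac)
  qed
  finally show ?thesis by simp
qed

definition exp_discrepancy :: "('v, 'e) pre_digraph \<Rightarrow> ('a \<times> 'a \<Rightarrow> real) \<Rightarrow> real" where
  "exp_discrepancy D f
    = (\<Sum>e\<in>arcs D. \<integral>p. \<bar>exp_rooted_density D f e p / exp_density D f - 1\<bar> \<partial>(M \<Otimes>\<^sub>M M))"

text \<open>Both sides are compared with the covariance of the arc sum and its exponential, as described at
  the top.\<close>

lemma variance_arc_sum_le_exp_discrepancy: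
  fixes K :: real
  assumes D: "oriented_graph D" and f_meas: "f \<in> borel_measurable (M \<Otimes>\<^sub>M M)"
    and lower: "\<And>p. - K \<le> f p" and upper: "\<And>p. f p \<le> 0"
  shows "(\<integral>x. (arc_sum D f x - real (card (arcs D)) * mean f)\<^sup>2 \<partial>power_measure (verts D))
    \<le> exp (real (card (arcs D)) * K) * K * exp_discrepancy D f"
proof -
  interpret digraph D using D by (simp add: oriented_graph_def)
  interpret Q: prob_space "M \<Otimes>\<^sub>M M" by (rule prob_space_square)
  let ?P = "power_measure (verts D)" and ?m = "real (card (arcs D))"
  interpret P: prob_space ?P by (rule prob_space_power)
  let ?S = "arc_sum D f" and ?t = "exp_density D f"
  have K: "0 \<le> K" using lower[of undefined] upper[of undefined] by linarith
  have f: "f \<in> bounded_measurable (M \<Otimes>\<^sub>M M)"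
    using lower upper K by (intro bounded_measurableI[where B = K] f_meas) (smt (verit))
  note S = bounded_measurable_arc_sum[OF D f]
  note expS = bounded_measurable_exp[OF S]
  have S_lower: "- (?m * K) \<le> ?S x" for x
    using sum_mono[of "arcs D" "\<lambda>_. - K" "\<lambda>e. f (x (tail D e), x (head D e))"] lower
    by (simp add: arc_sum_def)
  have S_upper: "?S x \<le> 0" for x
    unfolding arc_sum_def by (intro sum_nonpos upper)
  have mean_lower: "- K \<le> mean f"
    using integral_mono[OF Q.integrable_const[of "- K"] Q.integrable_bounded_measurable[OF f]] lower
    by (simp add: mean_def Q.prob_space)
  have mean_upper: "mean f \<le> 0"
    using integral_mono[OF Q.integrable_bounded_measurable[OF f] Q.integrable_const[of 0]] upper
    by (simp add: mean_def)
  have t_pos: "0 < ?t"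
  proof -
    have "exp (- (?m * K)) = (\<integral>x. exp (- (?m * K)) \<partial>?P)" by (simp add: P.prob_space)
    also have "\<dots> \<le> ?t"
      unfolding exp_density_def
      by (intro integral_mono P.integrable_const P.integrable_bounded_measurable expS)
         (simp add: S_lower)
    finally show ?thesis using exp_gt_zero[of "- (?m * K)"] by linarith
  qed
  have t_le: "?t \<le> 1"
  proof -
    have "?t \<le> (\<integral>x. 1 \<partial>?P)"
      unfolding exp_density_def
      by (intro integral_mono P.integrable_const P.integrable_bounded_measurable expS)
         (simp add: S_upper)
    then show ?thesis by (simp add: P.prob_space)
  qed
  have centred: "(\<lambda>p. f p - mean f) \<in> bounded_measurable (M \<Otimes>\<^sub>M M)"
    by (intro bounded_measurable_intros f)
  have centred_0: "(\<integral>p. f p - mean f \<partial>(M \<Otimes>\<^sub>M M)) = 0"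
    using Q.integrable_bounded_measurable[OF f] by (simp add: mean_def Q.prob_space)
  have centred_K: "\<bar>f p - mean f\<bar> \<le> K" for p
    using lower[of p] upper[of p] mean_lower mean_upper by linarith
  have S_centred: "(\<lambda>x. ?S x - ?m * mean f) \<in> bounded_measurable ?P"
    by (intro bounded_measurable_intros S)
  have S_centred_0: "(\<integral>x. ?S x - ?m * mean f \<partial>?P) = 0"
    using P.integrable_bounded_measurable[OF S] by (simp add: integral_arc_sum[OF D f] P.prob_space)

  \<comment> \<open>The constant \<open>exp (m * mean f)\<close> is subtracted for the monotonicity bound and disappears again
    because \<open>?S - m * mean f\<close> has integral zero.\<close>
  have "exp (- (?m * K)) * (\<integral>x. (?S x - ?m * mean f)\<^sup>2 \<partial>?P)
      = (\<integral>x. exp (- (?m * K)) * (?S x - ?m * mean f)\<^sup>2 \<partial>?P)"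
    by simp
  also have "\<dots> \<le> (\<integral>x. (exp (?S x) - exp (?m * mean f)) * (?S x - ?m * mean f) \<partial>?P)"
  proof (intro integral_mono P.integrable_bounded_measurable bounded_measurable_intros expS S)
    have "- (?m * K) \<le> ?m * mean f"
      using mult_left_mono[OF mean_lower, of ?m] by simp
    then show "exp (- (?m * K)) * (?S x - ?m * mean f)\<^sup>2
        \<le> (exp (?S x) - exp (?m * mean f)) * (?S x - ?m * mean f)" for x
      by (intro exp_strongly_monotone S_lower)
  qed
  also have "\<dots> = (\<integral>x. exp (?S x) * (?S x - ?m * mean f) \<partial>?P)"
    using P.integrable_bounded_measurable[OF bounded_measurable_mult[OF expS S_centred]]
      P.integrable_bounded_measurable[OF S_centred] S_centred_0
    by (simp add: left_diff_distrib[of "exp a" for a])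
  also have "\<dots> = (\<integral>x. (\<Sum>e\<in>arcs D. exp (?S x) * (f (x (tail D e), x (head D e)) - mean f)) \<partial>?P)"
    by (simp add: sum_distrib_left[symmetric] sum_subtractf arc_sum_def[of D f])
  also have "\<dots> = (\<Sum>e\<in>arcs D.
      \<integral>x. exp (?S x) * (f (x (tail D e), x (head D e)) - mean f) \<partial>?P)"
    by (intro Bochner_Integration.integral_sum P.integrable_bounded_measurable
        bounded_measurable_mult expS bounded_measurable_two_coordinates[OF centred]) auto
  also have "\<dots> = (\<Sum>e\<in>arcs D. \<integral>p. exp_rooted_density D f e p * (f p - mean f) \<partial>(M \<Otimes>\<^sub>M M))"
    by (intro sum.cong refl integral_exp_arc_sum_mult[OF D f _ centred])
  also have "\<dots> \<le> (\<Sum>e\<in>arcs D. ?t * K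
      * (\<integral>p. \<bar>exp_rooted_density D f e p / ?t - 1\<bar> \<partial>(M \<Otimes>\<^sub>M M)))"
    by (intro sum_mono integral_exp_rooted_density_mult_le[OF D f _ centred centred_0 _ t_pos]
        centred_K)
  also have "\<dots> = ?t * (K * exp_discrepancy D f)"
    by (simp add: exp_discrepancy_def sum_distrib_left mult.assoc)
  also have "\<dots> \<le> K * exp_discrepancy D f"
    using t_le K
    by (intro mult_left_le_one_le mult_nonneg_nonneg)
       (auto simp: exp_discrepancy_def intro!: sum_nonneg less_imp_le[OF t_pos])
  finally have "exp (?m * K) * (exp (- (?m * K)) * (\<integral>x. (?S x - ?m * mean f)\<^sup>2 \<partial>?P))
      \<le> exp (?m * K) * (K * exp_discrepancy D f)"
    by (intro mult_left_mono) auto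
  then show ?thesis
    by (simp add: mult.assoc[symmetric] exp_add[symmetric])
qed

end

section \<open>Lebesgue measurable kernels and Borel representatives\<close>

text \<open>Completeness makes \<open>f\<close> measurable, so only the representative \<open>f'\<close> has to be measurable.\<close>

lemma integral_completion_AE_eq:
  fixes f f' :: "'a \<Rightarrow> real"
  assumes f': "f' \<in> borel_measurable M" and eq: "AE x in M. f x = f' x"
  shows "integral\<^sup>L (completion M) f = integral\<^sup>L M f'"
proof -
  have f'_compl: "f' \<in> borel_measurable (completion M)"
    by (rule measurable_completion[OF f'])
  have AE: "AE x in completion M. f x = f' x"
    by (rule AE_completion[OF eq])
  have f: "f \<in> borel_measurable (completion M)"
  proof (rule measurableI)
    fix A :: "real set" assume "A \<in> sets borel"
    show "f -` A \<inter> space (completion M) \<in> sets (completion M)"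
    proof (rule completion.in_sets_AE)
      show "AE x in completion M. x \<in> f' -` A \<inter> space (completion M)
          \<longleftrightarrow> x \<in> f -` A \<inter> space (completion M)"
        using AE by eventually_elim simp
      show "f' -` A \<inter> space (completion M) \<in> sets (completion M)"
        by (rule measurable_sets[OF f'_compl \<open>A \<in> sets borel\<close>])
    qed simp
  qed simp
  have "integral\<^sup>L (completion M) f = integral\<^sup>L (completion M) f'"
    by (rule integral_cong_AE[OF f f'_compl AE])
  also have "\<dots> = integral\<^sup>L M f'"
    by (rule integral_completion[OF f'])
  finally show ?thesis .
qed

abbreviation unit_interval :: "real measure" where
  "unit_interval \<equiv> restrict_space lborel {0..1}"

lemma prob_space_unit_interval: "prob_space unit_interval"
  by (rule prob_spaceI) (simp add: emeasure_restrict_space)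

lemma sets_unit_square: "{0..1} \<times> {0..1} \<in> sets (lborel :: (real \<times> real) measure)"
  by (simp add: borel_closed closed_Times)

text \<open>Identifies the abstract square \<open>N \<Otimes>\<^sub>M N\<close> for \<open>N\<close> the unit interval with Borel-Lebesgue measure
  on the unit square, of which \<open>unit_square\<close> is the completed version.\<close>

lemma unit_interval_pair_eq:
  "unit_interval \<Otimes>\<^sub>M unit_interval = restrict_space lborel ({0..1} \<times> {0..1})"
proof (rule pair_measure_eqI)
  interpret prob_space unit_interval by (rule prob_space_unit_interval)
  show "sigma_finite_measure unit_interval" "sigma_finite_measure unit_interval"
    by unfold_locales
  let ?S = "{0..1} \<times> {0..1} :: (real \<times> real) set"
  let ?Q = "unit_interval \<Otimes>\<^sub>M unit_interval" and ?R = "restrict_space lborel ?S"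
  have S: "?S \<in> sets lborel" by (rule sets_unit_square)
  have id1: "(\<lambda>p. p) \<in> ?Q \<rightarrow>\<^sub>M ?R"
  proof (rule measurable_restrict_space2)
    show "(\<lambda>p. p) \<in> space ?Q \<rightarrow> ?S"
      by (auto simp: space_pair_measure)
    have "(\<lambda>p. (fst p, snd p)) \<in> ?Q \<rightarrow>\<^sub>M borel \<Otimes>\<^sub>M borel"
      by (intro measurable_Pair measurable_compose[OF measurable_fst] measurable_compose[OF measurable_snd])
        (auto intro!: measurable_restrict_space1)
    then show "(\<lambda>p. p) \<in> ?Q \<rightarrow>\<^sub>M lborel"
      by (simp add: borel_prod)
  qed
  have id2: "(\<lambda>p. p) \<in> ?R \<rightarrow>\<^sub>M ?Q"
  proof -
    have fst: "fst \<in> ?R \<rightarrow>\<^sub>M borel" and snd: "snd \<in> ?R \<rightarrow>\<^sub>M borel"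
      by (auto intro!: measurable_restrict_space1 borel_measurable_continuous_onI continuous_intros)
    have "(\<lambda>p. (fst p, snd p)) \<in> ?R \<rightarrow>\<^sub>M ?Q"
      using fst snd by (intro measurable_Pair measurable_restrict_space2) (auto simp: space_restrict_space)
    then show ?thesis by simp
  qed
  have space: "space ?Q = ?S" "space ?R = ?S"
    by (auto simp: space_pair_measure space_restrict_space)
  show "sets ?Q = sets ?R"
  proof (intro equalityI subsetI)
    fix A assume A: "A \<in> sets ?Q"
    then have "A \<subseteq> ?S" using sets.sets_into_space[OF A] by (simp add: space)
    with measurable_sets[OF id2 A] show "A \<in> sets ?R" by (simp add: space Int_absorb2)
  next
    fix A assume A: "A \<in> sets ?R"
    then have "A \<subseteq> ?S" using sets.sets_into_space[OF A] by (simp add: space)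
    with measurable_sets[OF id1 A] show "A \<in> sets ?Q" by (simp add: space Int_absorb2)
  qed
  fix A B assume "A \<in> sets unit_interval" "B \<in> sets unit_interval"
  then have AB: "A \<in> sets lborel" "B \<in> sets lborel" "A \<subseteq> {0..1}" "B \<subseteq> {0..1}"
    by (auto simp: sets_restrict_space_iff)
  have "emeasure ?R (A \<times> B) = emeasure lborel (A \<times> B)"
    using AB S by (intro emeasure_restrict_space) auto
  also have "\<dots> = emeasure lborel A * emeasure lborel B"
    unfolding lborel_prod[symmetric] using AB by (intro lborel.emeasure_pair_measure_Times) auto
  finally show "emeasure unit_interval A * emeasure unit_interval B = emeasure ?R (A \<times> B)"
    using AB by (simp add: emeasure_restrict_space)
qed

lemma AE_unit_square_iff:
  "(AE p in unit_square. P p) \<longleftrightarrow> (AE p in unit_interval \<Otimes>\<^sub>M unit_interval. P p)"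
  unfolding unit_square_def unit_interval_pair_eq
  using sets_unit_square by (simp add: AE_restrict_space_iff AE_completion_iff)

lemma integral_unit_square_AE_eq:
  assumes f': "f' \<in> borel_measurable (unit_interval \<Otimes>\<^sub>M unit_interval)"
    and eq: "AE p in unit_interval \<Otimes>\<^sub>M unit_interval. f p = f' p"
  shows "(\<integral>p. f p \<partial>unit_square) = (\<integral>p. f' p \<partial>(unit_interval \<Otimes>\<^sub>M unit_interval) :: real)"
proof -
  let ?S = "{0..1} \<times> {0..1} :: (real \<times> real) set"
  have "(\<integral>p. f p \<partial>unit_square) = (\<integral>p. indicator ?S p *\<^sub>R f p \<partial>lebesgue)"
    unfolding unit_square_def by (rule integral_restrict_space) (use sets_unit_square in simp)
  also have "\<dots> = (\<integral>p. indicator ?S p *\<^sub>R f' p \<partial>lborel)"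
  proof (rule integral_completion_AE_eq)
    show "(\<lambda>p. indicator ?S p *\<^sub>R f' p) \<in> borel_measurable lborel"
      using f' sets_unit_square unfolding unit_interval_pair_eq by (subst (asm) borel_measurable_restrict_space_iff) auto
    have "AE p in lborel. p \<in> ?S \<longrightarrow> f p = f' p"
      using eq sets_unit_square unfolding unit_interval_pair_eq by (simp add: AE_restrict_space_iff)
    then show "AE p in lborel. indicator ?S p *\<^sub>R f p = indicator ?S p *\<^sub>R f' p"
      by eventually_elim (auto simp: indicator_def)
  qed
  also have "\<dots> = (\<integral>p. f' p \<partial>(unit_interval \<Otimes>\<^sub>M unit_interval))"
    unfolding unit_interval_pair_eq by (rule integral_restrict_space[symmetric]) (use sets_unit_square in simp)
  finally show ?thesis .
qed

lemma kernel_lower_bound_le_1: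
  assumes "AE p in unit_square. \<alpha> \<le> W p \<and> W p \<le> (1 :: real)"
  shows "\<alpha> \<le> 1"
proof -
  interpret I: prob_space unit_interval by (rule prob_space_unit_interval)
  interpret Q: prob_space "unit_interval \<Otimes>\<^sub>M unit_interval" by (rule I.prob_space_square)
  have "AE p in unit_interval \<Otimes>\<^sub>M unit_interval. \<alpha> \<le> 1"
    using assms unfolding AE_unit_square_iff by eventually_elim simp
  then show ?thesis by simp
qed

text \<open>A Borel representative of \<open>W\<close> is clipped to \<open>[\<alpha>, 1]\<close> before taking the logarithm, so that the
  bounds hold everywhere and not just almost everywhere.\<close>

lemma Borel_log_kernel:
  assumes W: "directed_kernel W" and \<alpha>: "0 < \<alpha>"
    and bounds: "AE p in unit_square. \<alpha> \<le> W p \<and> W p \<le> 1"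
  obtains f where "f \<in> borel_measurable (unit_interval \<Otimes>\<^sub>M unit_interval)"
    and "AE p in unit_interval \<Otimes>\<^sub>M unit_interval. W p = exp (f p)"
    and "\<And>p. - ln (1 / \<alpha>) \<le> f p" and "\<And>p. f p \<le> 0"
proof -
  let ?S = "{0..1} \<times> {0..1} :: (real \<times> real) set"
  let ?Q = "unit_interval \<Otimes>\<^sub>M unit_interval"
  have \<alpha>1: "\<alpha> \<le> 1" by (rule kernel_lower_bound_le_1[OF bounds])
  have "(\<lambda>p. indicator ?S p *\<^sub>R W p) \<in> borel_measurable lebesgue"
    using W sets_unit_square unfolding directed_kernel_def unit_square_def
    by (subst (asm) borel_measurable_restrict_space_iff) auto
  then obtain g where g: "g \<in> borel_measurable lborel"
    and "AE p in lborel. indicator ?S p *\<^sub>R W p = g p"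
    using completion_ex_borel_measurable_real by blast
  then have "AE p in lborel. p \<in> ?S \<longrightarrow> W p = g p"
    by (auto elim!: eventually_mono)
  then have Wg: "AE p in ?Q. W p = g p"
    using sets_unit_square unfolding unit_interval_pair_eq by (simp add: AE_restrict_space_iff)
  define f where "f p = ln (max \<alpha> (min 1 (g p)))" for p
  show ?thesis
  proof
    have "g \<in> borel_measurable ?Q"
      unfolding unit_interval_pair_eq by (rule measurable_restrict_space1[OF g])
    then show "f \<in> borel_measurable ?Q"
      unfolding f_def by simp
    show "AE p in ?Q. W p = exp (f p)"
      using Wg bounds[unfolded AE_unit_square_iff]
      by eventually_elim (use \<alpha> in \<open>simp add: f_def\<close>)
    show "- ln (1 / \<alpha>) \<le> f p" for p
      using \<alpha> by (simp add: f_def ln_div)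
    show "f p \<le> 0" for p
      using \<alpha> \<alpha>1 by (simp add: f_def)
  qed
qed

lemma AE_hom_integrand_eq:
  assumes D: "oriented_graph D"
    and eq: "AE p in unit_interval \<Otimes>\<^sub>M unit_interval. W p = exp (f p)"
  shows "AE x in PiM (verts D) (\<lambda>_. unit_interval). hom_integrand D W x = exp (arc_sum D f x)"
proof -
  interpret I: prob_space unit_interval by (rule prob_space_unit_interval)
  interpret digraph D using D by (simp add: oriented_graph_def)
  have "AE x in I.power_measure (verts D). \<forall>e\<in>arcs D.
      W (x (tail D e), x (head D e)) = exp (f (x (tail D e), x (head D e)))"
    using no_loops by (intro AE_finite_allI I.AE_two_coordinates eq) auto
  then show ?thesis
    by eventually_elim (simp add: hom_integrand_def arc_sum_def exp_sum)
qed

lemma hom_density_eq_exp_density: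
  assumes D: "oriented_graph D"
    and f: "f \<in> bounded_measurable (unit_interval \<Otimes>\<^sub>M unit_interval)"
    and eq: "AE p in unit_interval \<Otimes>\<^sub>M unit_interval. W p = exp (f p)"
  shows "hom_density D W = prob_space.exp_density unit_interval D f"
proof -
  interpret I: prob_space unit_interval by (rule prob_space_unit_interval)
  show ?thesis
    unfolding hom_density_def I.exp_density_def unit_cube_def
    by (intro integral_completion_AE_eq AE_hom_integrand_eq[OF D eq] bounded_measurable_borel
        bounded_measurable_exp I.bounded_measurable_arc_sum[OF D f])
qed

text \<open>The integrands agree almost everywhere on the full cube, hence, by Fubini, on almost every fibre
  over the two root coordinates.\<close>

lemma AE_arc_rooted_density_eq:
  assumes D: "oriented_graph D" and e: "e \<in> arcs D"
    and f: "f \<in> bounded_measurable (unit_interval \<Otimes>\<^sub>M unit_interval)"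
    and eq: "AE p in unit_interval \<Otimes>\<^sub>M unit_interval. W p = exp (f p)"
  shows "AE p in unit_interval \<Otimes>\<^sub>M unit_interval.
    arc_rooted_density D W e p = prob_space.exp_rooted_density unit_interval D f e p"
proof -
  interpret I: prob_space unit_interval by (rule prob_space_unit_interval)
  interpret digraph D using D by (simp add: oriented_graph_def)
  let ?i = "tail D e" and ?j = "head D e"
  let ?R = "I.power_measure (verts D - {?i, ?j})"
  have ij: "?i \<in> verts D" "?j \<in> verts D" "?i \<noteq> ?j"
    using e no_loops by auto
  have "AE p in unit_interval \<Otimes>\<^sub>M unit_interval. AE z in ?R.
      hom_integrand D W (I.insert_pair ?i ?j (p, z)) = exp (arc_sum D f (I.insert_pair ?i ?j (p, z)))"
    by (rule I.AE_insert_pair[OF finite_verts ij AE_hom_integrand_eq[OF D eq]])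
  moreover have "AE p in unit_interval \<Otimes>\<^sub>M unit_interval. p \<in> space (unit_interval \<Otimes>\<^sub>M unit_interval)"
    by (rule AE_space)
  ultimately show ?thesis
  proof eventually_elim
    fix p assume p: "p \<in> space (unit_interval \<Otimes>\<^sub>M unit_interval)"
      and AE: "AE z in ?R. hom_integrand D W (I.insert_pair ?i ?j (p, z))
        = exp (arc_sum D f (I.insert_pair ?i ?j (p, z)))"
    have "(\<lambda>z. I.insert_pair ?i ?j (p, z)) \<in> ?R \<rightarrow>\<^sub>M I.power_measure (verts D)"
      by (rule measurable_compose[OF measurable_Pair1'[OF p] I.measurable_insert_pair[OF ij(1,2)]])
    then have "(\<lambda>z. exp (arc_sum D f (I.insert_pair ?i ?j (p, z)))) \<in> borel_measurable ?R"
      by (intro bounded_measurable_borel bounded_measurable_exp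
          bounded_measurable_compose[OF I.bounded_measurable_arc_sum[OF D f]])
    from integral_completion_AE_eq[OF this AE]
    show "arc_rooted_density D W e p = I.exp_rooted_density D f e p"
      by (simp add: arc_rooted_density_def I.exp_rooted_density_def unit_cube_def
          I.insert_pair_def case_prod_unfold)
  qed
qed

lemma arc_discrepancy_eq_exp_discrepancy:
  assumes D: "oriented_graph D"
    and f: "f \<in> bounded_measurable (unit_interval \<Otimes>\<^sub>M unit_interval)"
    and eq: "AE p in unit_interval \<Otimes>\<^sub>M unit_interval. W p = exp (f p)"
  shows "arc_discrepancy D W = prob_space.exp_discrepancy unit_interval D f"
proof -
  interpret I: prob_space unit_interval by (rule prob_space_unit_interval)
  show ?thesis
    unfolding arc_discrepancy_def I.exp_discrepancy_def L1_norm_def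
  proof (intro sum.cong refl integral_unit_square_AE_eq)
    fix e assume e: "e \<in> arcs D"
    show "(\<lambda>p. \<bar>I.exp_rooted_density D f e p / I.exp_density D f - 1\<bar>)
        \<in> borel_measurable (unit_interval \<Otimes>\<^sub>M unit_interval)"
      using bounded_measurable_borel[OF I.bounded_measurable_exp_rooted_density[OF D f e]]
      by (intro borel_measurable_abs borel_measurable_diff borel_measurable_divide
          borel_measurable_const)
    show "AE p in unit_interval \<Otimes>\<^sub>M unit_interval. \<bar>normalized_arc_density D W e p - 1\<bar>
        = \<bar>I.exp_rooted_density D f e p / I.exp_density D f - 1\<bar>"
      using AE_arc_rooted_density_eq[OF D e f eq]
      by eventually_elim
         (simp add: normalized_arc_density_def hom_density_eq_exp_density[OF D f eq])
  qed
qed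

theorem theorem5p2:
  fixes D :: "('v, 'e) pre_digraph"
    and W :: "real \<times> real \<Rightarrow> real"
    and \<alpha> M ubar :: real
    and m :: nat
  assumes "oriented_graph D"
    and "\<not> eulerian D"
    and "m = card (arcs D)"
    and "m \<ge> 1"
    and "directed_kernel W"
    and "0 < \<alpha>"
    and "AE p in unit_square. \<alpha> \<le> W p \<and> W p \<le> 1"
    and "M = ln (1 / \<alpha>)"
    and "ubar = (\<integral>p. ln (W p) \<partial>unit_square)"
  shows "degree_gap D > 0 \<and>
    (L2_norm (\<lambda>p. ln (W p) - ubar))\<^sup>2
      \<le> max (1 / degree_gap D) (1 / real m)
          * (2 * exp (real m * M) + (real m)\<^sup>2 * M\<^sup>2) * M * arc_discrepancy D W"
proof -
  interpret digraph D using assms(1) by (simp add: oriented_graph_def)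
  interpret I: prob_space unit_interval by (rule prob_space_unit_interval)
  let ?Q = "unit_interval \<Otimes>\<^sub>M unit_interval"
  interpret Q: prob_space ?Q by (rule I.prob_space_square)
  have arcs: "arcs D \<noteq> {}" using assms(3,4) by auto
  have gap: "0 < degree_gap D"
    by (rule degree_gap_pos[OF _ assms(2) arcs]) unfold_locales
  obtain f where f_meas: "f \<in> borel_measurable ?Q" and Wf: "AE p in ?Q. W p = exp (f p)"
    and lower: "\<And>p. - M \<le> f p" and upper: "\<And>p. f p \<le> 0"
    using Borel_log_kernel[OF assms(5-7)] unfolding assms(8) by blast
  have M: "0 \<le> M" using lower[of undefined] upper[of undefined] by linarith
  have f: "f \<in> bounded_measurable ?Q"
    using lower upper M by (intro bounded_measurableI[where B = M] f_meas) (smt (verit))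
  have disc: "arc_discrepancy D W = I.exp_discrepancy D f"
    by (rule arc_discrepancy_eq_exp_discrepancy[OF assms(1) f Wf])
  have ubar: "ubar = I.mean f"
    unfolding assms(9) I.mean_def
    by (rule integral_unit_square_AE_eq[OF f_meas]) (use Wf in eventually_elim, simp)
  have "(\<integral>p. (ln (W p) - ubar)\<^sup>2 \<partial>unit_square) = (\<integral>p. (f p - I.mean f)\<^sup>2 \<partial>?Q)"
  proof (rule integral_unit_square_AE_eq)
    show "(\<lambda>p. (f p - I.mean f)\<^sup>2) \<in> borel_measurable ?Q" using f_meas by simp
    show "AE p in ?Q. (ln (W p) - ubar)\<^sup>2 = (f p - I.mean f)\<^sup>2"
      using Wf by eventually_elim (simp add: ubar)
  qed
  then have "(L2_norm (\<lambda>p. ln (W p) - ubar))\<^sup>2 = (\<integral>p. (f p - I.mean f)\<^sup>2 \<partial>?Q)"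
    by (simp add: L2_norm_def)
  also have "\<dots> \<le> max (1 / degree_gap D) (1 / real m)
      * (\<integral>x. (arc_sum D f x - real m * I.mean f)\<^sup>2 \<partial>I.power_measure (verts D))"
    unfolding assms(3) by (rule I.square_distance_le_variance_arc_sum[OF assms(1,2) arcs f])
  also have "\<dots> \<le> max (1 / degree_gap D) (1 / real m)
      * ((2 * exp (real m * M) + (real m)\<^sup>2 * M\<^sup>2) * (M * arc_discrepancy D W))"
  proof (rule mult_left_mono)
    have "(\<integral>x. (arc_sum D f x - real m * I.mean f)\<^sup>2 \<partial>I.power_measure (verts D))
        \<le> exp (real m * M) * M * I.exp_discrepancy D f"
      unfolding assms(3)
      by (rule I.variance_arc_sum_le_exp_discrepancy[OF assms(1) f_meas lower upper])
    also have "\<dots> = exp (real m * M) * (M * arc_discrepancy D W)"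
      by (simp add: disc)
    also have "\<dots> \<le> (2 * exp (real m * M) + (real m)\<^sup>2 * M\<^sup>2) * (M * arc_discrepancy D W)"
    proof (rule mult_right_mono)
      show "exp (real m * M) \<le> 2 * exp (real m * M) + (real m)\<^sup>2 * M\<^sup>2"
        using exp_gt_zero[of "real m * M"] by (simp add: add_increasing2)
      show "0 \<le> M * arc_discrepancy D W"
        using M by (auto simp: disc I.exp_discrepancy_def intro!: mult_nonneg_nonneg sum_nonneg)
    qed
    finally show "(\<integral>x. (arc_sum D f x - real m * I.mean f)\<^sup>2 \<partial>I.power_measure (verts D))
        \<le> (2 * exp (real m * M) + (real m)\<^sup>2 * M\<^sup>2) * (M * arc_discrepancy D W)" .
    show "0 \<le> max (1 / degree_gap D) (1 / real m)"
      by (rule max.coboundedI2) simp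
  qed
  finally show ?thesis using gap by (simp only: mult.assoc simp_thms)
qed

end
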